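(* Let $q$ be a power of a prime $p$ and let $$\nu_q=\min\{\deg f: f\in\mathbf{F}_q[T],\ f'=1,\ f|_{\mathbf{F}_q}=\operatorname{id},\ \text{and } f \text{ is nonexceptional}\}.$$ Then $$\nu_q\geq p(q+1).$$ Equality holds for every odd $q$ and for $q=2$. For even $q>2$, one has $$p(q+1)\leq\nu_q\leq p(q+\ell_q-1),$$ where $\ell_q$ denotes the least prime divisor of $q-1$.
   Context: For $f\in\mathbf{F}_q[T]$, let $\mathcal{S}_q(f)=\{m\in\mathbf{N}_{>0}: f\colon\mathbf{F}_{q^m}\to\mathbf{F}_{q^m}\text{ is bijective}\}$. $f$ is exceptional if $\mathcal{S}_q(f)$ is infinite, and nonexceptional otherwise. Here $f|_{\mathbf{F}_q}=\operatorname{id}$ means $f(a)=a$ for all $a\in\mathbf{F}_q$. *)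

theory Defs
  imports "HOL-Library.Cardinality" "HOL-Algebra.Algebraic_Closure_Type" "HOL-Number_Theory.Residues"
begin

text \<open>
  The base field \<open>F_q\<close> is a type of class \<^class>\<open>finite_field\<close>, with \<open>q = CARD('a)\<close>. Its
  extension of degree \<open>m\<close> is realised inside the algebraic closure as the set of solutions of
  \<open>x^(q^m) = x\<close>; the lemmas below confirm that for \<open>m > 0\<close> this is a field with \<open>q^m\<close> elements
  that contains \<open>F_q\<close>.
\<close>

definition ext_field :: "nat \<Rightarrow> 'a::finite_field alg_closure set" where
  "ext_field m = {x. x ^ (CARD('a) ^ m) = x}"

definition bij_degrees :: "'a::finite_field poly \<Rightarrow> nat set" where
  "bij_degrees f = {m. m > 0 \<and> bij_betw (poly (map_poly to_ac f)) (ext_field m) (ext_field m)}"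

definition exceptional :: "'a::finite_field poly \<Rightarrow> bool" where
  "exceptional f \<longleftrightarrow> infinite (bij_degrees f)"

definition nu_polys :: "'a::finite_field itself \<Rightarrow> 'a poly set" where
  "nu_polys _ = {f. pderiv f = 1 \<and> (\<forall>a. poly f a = a) \<and> \<not> exceptional f}"

text \<open>
  \<^const>\<open>Inf\<close> on \<^typ>\<open>nat\<close> is the minimum of a nonempty set, and carries no information for the
  empty set.
\<close>

definition nu :: "'a::finite_field itself \<Rightarrow> nat" where
  "nu T = Inf (Polynomial.degree ` nu_polys T)"

definition least_prime_divisor :: "nat \<Rightarrow> nat" where
  "least_prime_divisor n = (LEAST r. prime r \<and> r dvd n)"


lemma range_to_ac_subset_ext_field: "range to_ac \<subseteq> (ext_field m :: 'a::finite_field alg_closure set)"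
  by (auto simp: ext_field_def finite_field_power_card_power_eq_same simp flip: to_ac_power)

lemma ext_field_mult: "x \<in> ext_field m \<Longrightarrow> y \<in> ext_field m \<Longrightarrow> x * y \<in> ext_field m"
  by (simp add: ext_field_def power_mult_distrib)

lemma ext_field_inverse: "x \<in> ext_field m \<Longrightarrow> inverse x \<in> ext_field m"
  by (simp add: ext_field_def power_inverse)

lemma card_ext_field:
  assumes "m > 0"
  shows "card (ext_field m :: 'a::finite_field alg_closure set) = CARD('a) ^ m"
proof -
  define N where "N = CARD('a) ^ m"
  define P :: "'a alg_closure poly" where "P = monom 1 N - monom 1 1"
  have "card {0, 1 :: 'a} \<le> CARD('a)"
    by (rule card_mono) auto
  hence "CARD('a) \<ge> 2"
    by simp
  hence N: "N > 1"
    unfolding N_def using assms by (intro one_less_power) simp_all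
  have "CHAR('a) dvd N"
    using CHAR_dvd_CARD[where ?'a = 'a] assms unfolding N_def by (meson dvd_power dvd_trans)
  hence "of_nat N = (0 :: 'a alg_closure)"
    by (simp add: of_nat_eq_0_iff_char_dvd)
  hence der: "pderiv P = -1"
    by (simp add: P_def pderiv_diff pderiv_monom one_pCons monom_0)
  hence P0: "P \<noteq> 0"
    by auto
  have "degree P = N"
    unfolding P_def diff_conv_add_uminus using N
    by (subst degree_add_eq_left) (simp_all add: degree_monom_eq)
  moreover obtain A c where A: "size A = degree P" "P = smult c (\<Prod>x\<in>#A. [:-x, 1:])"
    using alg_closed_imp_factorization[OF P0] by blast
  moreover have "c \<noteq> 0"
    using P0 A(2) by auto
  hence roots: "poly P x = 0 \<longleftrightarrow> x \<in># A" for x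
    by (auto simp: A(2) poly_prod_mset prod_mset_zero_iff)
  have count_le: "count A x \<le> 1" for x
  proof (rule ccontr)
    assume "\<not> count A x \<le> 1"
    hence "count A x \<noteq> 0" "count (A - {#x#}) x \<noteq> 0"
      by simp_all
    hence "x \<in># A" "x \<in># A - {#x#}"
      using not_in_iff by metis+
    then obtain B where B: "A = add_mset x (add_mset x B)"
      by (metis insert_DiffM)
    define Q where "Q = smult c (\<Prod>y\<in>#B. [:-y, 1:])"
    have "P = [:-x, 1:] * ([:-x, 1:] * Q)"
      unfolding A(2) B Q_def by (simp only: image_mset_add_mset prod_mset.add_mset mult_smult_right)
    hence "poly (pderiv P) x = 0"
      by (simp only: pderiv_mult poly_add poly_mult) simp
    thus False
      by (simp add: der)
  qed
  have "count A x = count (mset_set (set_mset A)) x" for x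
  proof (cases "x \<in># A")
    case True
    hence "count A x \<ge> 1"
      by simp
    with count_le[of x] have "count A x = 1"
      by linarith
    thus ?thesis
      using True by simp
  next
    case False
    hence "count A x = 0"
      by (simp only: count_eq_zero_iff not_False_eq_True)
    thus ?thesis
      using False by simp
  qed
  hence "A = mset_set (set_mset A)"
    by (rule multiset_eqI)
  hence "card (set_mset A) = size A"
    by (metis size_mset_set)
  moreover have "set_mset A = ext_field m"
    using roots by (auto simp: ext_field_def P_def N_def poly_monom)
  ultimately show ?thesis
    using A(1) by (simp add: N_def)
qed

lemma ext_field_add:
  fixes x y :: "'a::finite_field alg_closure"
  assumes "prime p" "CARD('a) = p ^ n" "x \<in> ext_field m" "y \<in> ext_field m"
  shows "x + y \<in> ext_field m"
proof -
  have prime: "prime CHAR('a)"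
    using prime_CHAR_semidom[where ?'a = 'a] finite_imp_CHAR_pos[where ?'a = 'a] by simp
  moreover have "CHAR('a) dvd p ^ n"
    using CHAR_dvd_CARD[where ?'a = 'a] assms(2) by simp
  ultimately have "CHAR('a) = p"
    using assms(1) by (metis prime_dvd_power primes_dvd_imp_eq)
  hence "(x + y) ^ (CARD('a) ^ m) = x ^ (CARD('a) ^ m) + y ^ (CARD('a) ^ m)"
    using prime by (intro freshmans_dream'[where n = "n * m"]) (simp_all add: assms(2) power_mult)
  thus ?thesis
    using assms(3,4) by (simp add: ext_field_def)
qed

end

theory Submission
  imports Defs "HOL-Library.Nat_Bijection" "HOL-Library.Disjoint_Sets"
begin

text \<open>
  A polynomial \<open>f\<close> with \<open>f' = 1\<close> that fixes \<open>F_q\<close> pointwise has the form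
  \<open>f = T + ((T^q - T) * G)^p\<close>. If \<open>G\<close> is constant, then \<open>f\<close> is additive, its kernel is a finite
  Frobenius-stable set that meets \<open>F_q\<close> only in \<open>0\<close>, and \<open>f\<close> is therefore injective on
  \<open>F_{q^m}\<close> whenever \<open>m\<close> is \<open>1\<close> modulo the periods of the kernel elements. So \<open>deg G \<ge> 1\<close>,
  which is the lower bound.

  For every \<open>q\<close>, even or odd, \<open>G = T\<close> gives a nonexceptional polynomial, so \<open>\<nu>_q = p * (q + 1)\<close>
  always. Indeed \<open>f (x + z) = f x\<close> with \<open>z = - w^p\<close>, \<open>w \<noteq> 0\<close> amounts to
  \<open>x^q + (z^(q - 1) - 2) * x + (z^q - z) = w / z\<close>, which is affine in \<open>x\<close>. For odd \<open>q\<close> and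
  \<open>m \<ge> 2\<close> some nonzero \<open>z \<in> F_{q^m}\<close> makes the linear part bijective, because \<open>u \<mapsto> 2 - u\<close> does
  not preserve the group of \<open>(q - 1)\<close>-th powers. For even \<open>q\<close> the substitution \<open>x = z * s\<close>,
  \<open>w = 1 / v\<close> turns the equation into \<open>s^q + s = 1 + v^(2 * q - 2) + v^(2 * q + 1)\<close>. If \<open>m\<close> is
  even, \<open>v = 1\<close> works. If \<open>m\<close> is odd, one needs \<open>v\<close> such that \<open>v^(2 * q - 2) + v^(2 * q + 1)\<close> has
  trace \<open>1\<close> over \<open>F_q\<close>; for large \<open>m\<close> it exists, since the indicator polynomial of the condition
  \<open>trace \<noteq> 1\<close> contains, after reduction modulo \<open>v^(q^m) - v\<close>, a nonconstant
  monomial. That monomial is isolated by counting binary digits of exponents.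
\<close>

section \<open>Frobenius and power sums in extensions of a finite field\<close>

lemma map_poly_to_ac_add: "map_poly to_ac (f + g) = map_poly to_ac f + map_poly to_ac g"
  by (rule poly_eqI) (simp add: coeff_map_poly)

lemma map_poly_to_ac_diff: "map_poly to_ac (f - g) = map_poly to_ac f - map_poly to_ac g"
  by (rule poly_eqI) (simp add: coeff_map_poly)

lemma map_poly_to_ac_mult: "map_poly to_ac (f * g) = map_poly to_ac f * map_poly to_ac g"
  by (rule poly_eqI) (simp add: coeff_map_poly coeff_mult to_ac_sum)

lemma map_poly_to_ac_power: "map_poly to_ac (f ^ k) = map_poly to_ac f ^ k"
  by (induction k) (simp_all add: map_poly_to_ac_mult)

lemmas poly_map_poly_to_ac =
  map_poly_to_ac_add map_poly_to_ac_diff map_poly_to_ac_mult map_poly_to_ac_power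
  map_poly_smult map_poly_pCons map_poly_monom poly_monom

lemma prime_CHAR_finite_field: "prime CHAR('a::finite_field)"
  using prime_CHAR_semidom[where ?'a = 'a] finite_imp_CHAR_pos[where ?'a = 'a] by simp

lemma card_finite_field_ge_2: "CARD('a::finite_field) \<ge> 2"
proof -
  have "card {0, 1 :: 'a} \<le> CARD('a)"
    by (rule card_mono) auto
  thus ?thesis
    by simp
qed

lemma two_eq_0_alg_closure:
  assumes "CHAR('a::field) = 2"
  shows "2 = (0 :: 'a alg_closure)"
  using of_nat_CHAR[where ?'a = "'a alg_closure"] assms by simp

context
  fixes n :: nat
  assumes card_eq: "CARD('a::finite_field) = CHAR('a) ^ n"
begin

lemma frob_add:
  fixes x y :: "'a alg_closure"
  shows "(x + y) ^ (CARD('a) ^ m) = x ^ (CARD('a) ^ m) + y ^ (CARD('a) ^ m)"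
  using prime_CHAR_finite_field[where ?'a = 'a]
  by (intro freshmans_dream'[where n = "n * m"]) (simp_all add: card_eq power_mult)

lemma frob_diff:
  fixes x y :: "'a alg_closure"
  shows "(x - y) ^ (CARD('a) ^ m) = x ^ (CARD('a) ^ m) - y ^ (CARD('a) ^ m)"
  using frob_add[of "x - y" y m] by simp

lemma frob_sum:
  fixes f :: "'b \<Rightarrow> 'a alg_closure"
  shows "(\<Sum>i\<in>A. f i) ^ (CARD('a) ^ m) = (\<Sum>i\<in>A. f i ^ (CARD('a) ^ m))"
  using prime_CHAR_finite_field[where ?'a = 'a]
  by (intro freshmans_dream_sum'[where n = "n * m"]) (simp_all add: card_eq power_mult)

lemmas frob_add1 = frob_add[where m = 1, simplified]
lemmas frob_diff1 = frob_diff[where m = 1, simplified]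
lemmas frob_sum1 = frob_sum[where m = 1, simplified]

lemma CHAR_power_diff_alg_closure:
  fixes x y :: "'a alg_closure"
  shows "(x - y) ^ CHAR('a) = x ^ CHAR('a) - y ^ CHAR('a)"
proof -
  have "(x - y + y) ^ CHAR('a) = (x - y) ^ CHAR('a) + y ^ CHAR('a)"
    using prime_CHAR_finite_field[where ?'a = 'a] by (intro freshmans_dream) simp_all
  thus ?thesis
    by (simp only: diff_add_cancel eq_diff_eq)
qed

lemma zero_in_ext_field [simp]: "(0 :: 'a alg_closure) \<in> ext_field m"
  and one_in_ext_field [simp]: "(1 :: 'a alg_closure) \<in> ext_field m"
  by (simp_all add: ext_field_def)

lemma ext_field_plus:
  fixes x y :: "'a alg_closure"
  shows "x \<in> ext_field m \<Longrightarrow> y \<in> ext_field m \<Longrightarrow> x + y \<in> ext_field m"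
  by (simp add: ext_field_def frob_add)

lemma ext_field_diff:
  fixes x y :: "'a alg_closure"
  shows "x \<in> ext_field m \<Longrightarrow> y \<in> ext_field m \<Longrightarrow> x - y \<in> ext_field m"
  by (simp add: ext_field_def frob_diff)

lemma ext_field_power:
  fixes x :: "'a alg_closure"
  shows "x \<in> ext_field m \<Longrightarrow> x ^ k \<in> ext_field m"
  by (induction k) (simp_all add: ext_field_mult)

lemma ext_field_sum:
  fixes f :: "'b \<Rightarrow> 'a alg_closure"
  shows "(\<And>i. i \<in> A \<Longrightarrow> f i \<in> ext_field m) \<Longrightarrow> (\<Sum>i\<in>A. f i) \<in> ext_field m"
  by (simp add: ext_field_def frob_sum)

lemma ext_field_divide:
  fixes x y :: "'a alg_closure"
  shows "x \<in> ext_field m \<Longrightarrow> y \<in> ext_field m \<Longrightarrow> x / y \<in> ext_field m"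
  by (simp add: ext_field_mult ext_field_inverse divide_inverse)

lemma ext_field_uminus:
  fixes x :: "'a alg_closure"
  shows "x \<in> ext_field m \<Longrightarrow> - x \<in> ext_field m"
  using ext_field_diff[of 0 m x] by simp

lemma finite_ext_field:
  assumes "m > 0"
  shows "finite (ext_field m :: 'a alg_closure set)"
  by (rule card_ge_0_finite) (simp add: card_ext_field assms finite_UNIV_card_ge_0)

lemma ext_field_power_card_minus_1:
  fixes x :: "'a alg_closure"
  assumes "x \<in> ext_field m" "x \<noteq> 0"
  shows "x ^ (CARD('a) ^ m - Suc 0) = 1"
proof -
  have "x * x ^ (CARD('a) ^ m - Suc 0) = x"
    using assms(1) finite_UNIV_card_ge_0[where ?'a = 'a] power_minus_mult[of "CARD('a) ^ m" x]
    by (simp add: ext_field_def mult.commute)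
  thus ?thesis
    using assms(2) by simp
qed

text \<open>Serves as coefficient extraction: multiplying by a power and summing over the field
  isolates one monomial. The case k = 0 is excluded because 0^0 = 1 makes that sum q^m = 0, although
  q^m - 1 divides 0.\<close>

lemma power_sum_ext_field:
  assumes "m > 0" "k > 0"
  shows "(\<Sum>x\<in>(ext_field m :: 'a alg_closure set). x ^ k) =
           (if CARD('a) ^ m - 1 dvd k then -1 else 0)"
proof (cases "CARD('a) ^ m - 1 dvd k")
  case True
  then obtain j where j: "k = (CARD('a) ^ m - 1) * j"
    by blast
  let ?L = "ext_field m :: 'a alg_closure set"
  have "(\<Sum>x\<in>?L. x ^ k) = (\<Sum>x\<in>?L - {0}. x ^ k)"
    using finite_ext_field[OF assms(1)] assms(2) by (subst sum.remove[of _ 0]) auto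
  also have "\<dots> = (\<Sum>x\<in>?L - {0}. 1)"
    by (intro sum.cong) (auto simp: j power_mult ext_field_power_card_minus_1)
  also have "\<dots> = of_nat (CARD('a) ^ m - 1)"
    using finite_ext_field[OF assms(1)] by (simp add: card_ext_field assms(1))
  also have "\<dots> = of_nat (CARD('a) ^ m) - 1"
    using finite_UNIV_card_ge_0[where ?'a = 'a] by (simp add: of_nat_diff)
  also have "of_nat (CARD('a) ^ m) = (0 :: 'a alg_closure)"
    using dvd_trans[OF CHAR_dvd_CARD[where ?'a = 'a] dvd_power, of m] assms(1)
    by (simp only: of_nat_eq_0_iff_char_dvd CHAR_alg_closure simp_thms)
  finally show ?thesis
    using True by simp
next
  case False
  let ?L = "ext_field m :: 'a alg_closure set"
  define N where "N = CARD('a) ^ m - 1"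
  define r where "r = k mod N"
  have "CARD('a) ^ m > 1"
    by (rule one_less_power) (use card_finite_field_ge_2[where ?'a = 'a] assms(1) in linarith)+
  hence "N > 0"
    by (simp only: N_def)
  hence r: "0 < r" "r < N"
    using False by (auto simp: r_def N_def mod_greater_zero_iff_not_dvd)
  \<comment> \<open>Otherwise X^r and 1 would agree at N points, while r < N.\<close>
  have "\<exists>g\<in>?L - {0}. g ^ r \<noteq> 1"
  proof (rule ccontr)
    assume *: "\<not> ?thesis"
    have "card (?L - {0}) = N"
      using finite_ext_field[OF assms(1)] by (simp add: card_ext_field assms(1) N_def)
    hence "monom 1 r = (1 :: 'a alg_closure poly)"
      using r * by (intro poly_eqI_degree[of "?L - {0}"]) (auto simp: poly_monom degree_monom_eq)
    hence "degree (monom 1 r :: 'a alg_closure poly) = 0"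
      by simp
    thus False
      using r(1) by (simp add: degree_monom_eq)
  qed
  then obtain g where g: "g \<in> ?L" "g \<noteq> 0" "g ^ r \<noteq> 1"
    by auto
  have "g ^ k = (g ^ N) ^ (k div N) * g ^ r"
    unfolding r_def by (simp flip: power_mult power_add)
  hence gk: "g ^ k \<noteq> 1"
    using g ext_field_power_card_minus_1[of g m] by (simp add: N_def)
  \<comment> \<open>Scaling by g permutes the field and multiplies the power sum by g^k, which is
    not 1.\<close>
  have "(\<Sum>x\<in>?L. x ^ k) = (\<Sum>x\<in>?L. (g * x) ^ k)"
    by (rule sum.reindex_bij_witness[of _ "\<lambda>x. g * x" "\<lambda>x. x / g"])
       (use g in \<open>auto simp: ext_field_mult ext_field_divide\<close>)
  also have "\<dots> = g ^ k * (\<Sum>x\<in>?L. x ^ k)"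
    by (simp add: power_mult_distrib sum_distrib_left)
  finally show ?thesis
    using gk False by simp
qed

end

section \<open>The lower bound\<close>

text \<open>A vanishing derivative leaves only exponents divisible by p, and c^(p^(n-1)) is a p-th
  root of c in F_q because c^q = c.\<close>

lemma poly_CHAR_power_root:
  fixes g :: "'a::finite_field poly"
  assumes card_eq: "CARD('a) = CHAR('a) ^ n" and "n > 0" and "pderiv g = 0"
  obtains h where "g = h ^ CHAR('a)"
proof -
  define p where "p = CHAR('a)"
  have p: "prime p"
    by (simp add: p_def prime_CHAR_finite_field)
  hence p0: "p > 0"
    by (rule prime_gt_0_nat)
  define c where "c = (\<lambda>i. coeff g (p * i) ^ (p ^ (n - 1)))"
  \<comment> \<open>The range overshoots the true degree; the extra coefficients are 0.\<close>
  define h where "h = (\<Sum>i\<le>degree g. monom (c i) i)"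
  have "(p ^ (n - 1)) * p = CARD('a)"
    using assms(2) card_eq by (cases n) (simp_all add: p_def)
  hence c: "c i ^ p = coeff g (p * i)" for i
    by (simp add: c_def finite_field_power_card_eq_same flip: power_mult)
  have "h ^ p = (\<Sum>i\<le>degree g. monom (c i) i ^ p)"
    unfolding h_def using p by (intro freshmans_dream_sum) (simp_all add: p_def)
  also have "\<dots> = (\<Sum>i\<le>degree g. monom (coeff g (p * i)) (p * i))"
    by (simp add: monom_power c mult.commute)
  also have "\<dots> = g"
  proof (rule poly_eqI)
    fix k
    show "coeff (\<Sum>i\<le>degree g. monom (coeff g (p * i)) (p * i)) k = coeff g k"
    proof (cases "p dvd k")
      case True
      then obtain j where j: "k = p * j"
        by blast
      have "coeff (\<Sum>i\<le>degree g. monom (coeff g (p * i)) (p * i)) k =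
              (\<Sum>i\<le>degree g. if i = j then coeff g (p * i) else 0)"
        using p0 by (auto simp: coeff_sum j intro!: sum.cong)
      also have "\<dots> = (if j \<le> degree g then coeff g k else 0)"
        by (simp add: j)
      also have "\<dots> = coeff g k"
      proof -
        have "j \<le> k"
          using p0 by (simp add: j)
        thus ?thesis
          by (auto simp: coeff_eq_0)
      qed
      finally show ?thesis .
    next
      case False
      have "k > 0"
        using False by (auto intro: Nat.gr0I)
      have "of_nat k * coeff g k = 0"
        using coeff_pderiv[of g "k - 1"] assms(3) \<open>k > 0\<close> by simp
      moreover have "of_nat k \<noteq> (0 :: 'a)"
        using False by (simp add: of_nat_eq_0_iff_char_dvd p_def)
      ultimately have "coeff g k = 0"
        by simp
      moreover have "coeff (\<Sum>i\<le>degree g. monom (coeff g (p * i)) (p * i)) k = 0"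
        using False by (auto simp: coeff_sum intro!: sum.neutral)
      ultimately show ?thesis
        by simp
    qed
  qed
  finally have "g = h ^ CHAR('a)"
    by (simp only: p_def)
  thus ?thesis
    by (rule that)
qed

lemma degree_monom_card_minus_X:
  "degree (monom 1 (CARD('a::finite_field)) - [:0, 1 :: 'a:]) = CARD('a)"
proof -
  have "degree (- [:0, 1 :: 'a:]) < degree (monom (1 :: 'a) (CARD('a)))"
    using card_finite_field_ge_2[where ?'a = 'a] by (simp add: degree_monom_eq)
  hence "degree (monom 1 (CARD('a)) + - [:0, 1 :: 'a:]) = CARD('a)"
    by (subst degree_add_eq_left) (simp_all add: degree_monom_eq)
  thus ?thesis
    by (simp only: diff_conv_add_uminus)
qed

text \<open>The q roots bound the degree from below; in degree q, the leading coefficient and the q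
  values determine the polynomial.\<close>

lemma vanishing_poly_degree:
  fixes h :: "'a::finite_field poly"
  assumes "\<And>a. poly h a = 0" "h \<noteq> 0"
  shows "CARD('a) \<le> degree h"
    and "degree h = CARD('a) \<Longrightarrow> \<exists>c. h = smult c (monom 1 (CARD('a)) - [:0, 1:])"
proof -
  show "CARD('a) \<le> degree h"
    using card_poly_roots_bound[OF assms(2)] assms(1) by simp
  let ?V = "monom 1 (CARD('a)) - [:0, 1 :: 'a:]"
  assume deg: "degree h = CARD('a)"
  have "h = smult (coeff h (CARD('a))) ?V"
  proof (rule poly_eqI_degree_lead_coeff[of _ "CARD('a)" _ UNIV])
    show "coeff h (CARD('a)) = coeff (smult (coeff h (CARD('a))) ?V) (CARD('a))"
      using card_finite_field_ge_2[where ?'a = 'a] by (simp add: coeff_pCons split: nat.splits)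
    show "poly h z = poly (smult (coeff h (CARD('a))) ?V) z" for z
      by (simp add: assms(1) poly_monom finite_field_power_card_eq_same)
    show "degree (smult (coeff h (CARD('a))) ?V) \<le> CARD('a)"
      using degree_smult_le[of _ ?V] by (simp add: degree_monom_card_minus_X)
  qed (simp_all add: deg)
  thus "\<exists>c. h = smult c ?V" ..
qed

text \<open>A Frobenius orbit inside a finite set repeats, and injectivity of Frobenius cancels the
  repetition to a genuine period. The product of the periods over \<open>Z\<close> is a common
  one.\<close>

lemma ext_field_period:
  fixes Z :: "'a::finite_field alg_closure set"
  assumes "CARD('a) = CHAR('a) ^ n" "finite Z" "\<And>x. x \<in> Z \<Longrightarrow> x ^ CARD('a) \<in> Z"
  obtains N where "N > 0" "\<And>x k. x \<in> Z \<Longrightarrow> x \<in> ext_field (N * k)"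
proof -
  have inj: "x = y" if "x ^ (CARD('a) ^ i) = y ^ (CARD('a) ^ i)" for x y :: "'a alg_closure" and i
    using frob_diff[OF assms(1), of x y i] that by simp
  have mem: "x ^ (CARD('a) ^ i) \<in> Z" if "x \<in> Z" for x i
    by (induction i) (use that in \<open>simp_all add: assms(3) power_mult mult.commute[of "CARD('a)"]\<close>)
  have "\<exists>N>0. x ^ (CARD('a) ^ N) = x" if "x \<in> Z" for x
  proof -
    have "\<not> inj (\<lambda>i. x ^ (CARD('a) ^ i))"
      using finite_subset[OF _ assms(2), of "range (\<lambda>i. x ^ (CARD('a) ^ i))"] mem[OF that]
        finite_imageD infinite_UNIV_nat by blast
    then obtain i j where ij: "i < j" "x ^ (CARD('a) ^ i) = x ^ (CARD('a) ^ j)"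
      unfolding inj_def by (metis linorder_neqE_nat)
    have "CARD('a) ^ j = CARD('a) ^ (j - i) * CARD('a) ^ i"
      using ij(1) by (simp flip: power_add)
    hence "x ^ (CARD('a) ^ (j - i)) = x"
      using ij(2) inj[of "x ^ (CARD('a) ^ (j - i))" i x] by (simp add: power_mult)
    thus ?thesis
      using ij(1) by (intro exI[of _ "j - i"]) simp
  qed
  then obtain N where N: "\<And>x. x \<in> Z \<Longrightarrow> N x > 0" "\<And>x. x \<in> Z \<Longrightarrow> x ^ (CARD('a) ^ N x) = x"
    by metis
  have iter: "x ^ (CARD('a) ^ (l * k)) = x" if "x ^ (CARD('a) ^ l) = x" for x :: "'a alg_closure" and l k
    by (induction k) (use that in \<open>simp_all add: power_add power_mult\<close>)
  show ?thesis
  proof (rule that[of "prod N Z"])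
    show "prod N Z > 0"
      using N(1) by (simp add: prod_pos)
    fix x k
    assume x: "x \<in> Z"
    have "prod N Z * k = N x * (prod N (Z - {x}) * k)"
      using x assms(2) by (simp add: prod.remove)
    thus "x \<in> ext_field (prod N Z * k)"
      using iter[OF N(2)[OF x]] by (simp only: ext_field_def mem_Collect_eq)
  qed
qed

text \<open>Here \<open>c\<close> stands for the p-th power of a constant G. Since \<open>c\<close>
  lies in F_q, the induced map commutes with Frobenius, so its kernel is Frobenius-stable.\<close>

lemma exceptional_additive:
  fixes c :: "'a::finite_field"
  assumes card_eq: "CARD('a) = CHAR('a) ^ n"
  defines "f \<equiv> [:0, 1:] + smult c ((monom 1 (CARD('a)) - [:0, 1:]) ^ CHAR('a))"
  assumes "f \<noteq> 0"
  shows "exceptional f"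
proof -
  define F where "F = poly (map_poly to_ac f)"
  define C where "C = to_ac c"
  note frob = frob_add1[OF card_eq] frob_diff1[OF card_eq]
  have C: "C ^ CARD('a) = C"
    by (simp add: C_def finite_field_power_card_eq_same flip: to_ac_power)
  have F: "F x = x + C * (x ^ CARD('a) - x) ^ CHAR('a)" for x
    by (simp add: F_def f_def poly_map_poly_to_ac C_def)
  have F_diff: "F (x - y) = F x - F y" for x y
  proof -
    have "F (x - y) = x - y + C * ((x ^ CARD('a) - x) - (y ^ CARD('a) - y)) ^ CHAR('a)"
      unfolding F frob by (simp add: algebra_simps)
    thus ?thesis
      unfolding CHAR_power_diff_alg_closure[OF card_eq] F by (simp add: algebra_simps)
  qed
  have F_frob: "F (x ^ CARD('a)) = F x ^ CARD('a)" for x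
  proof -
    have "((x ^ CARD('a) - x) ^ CHAR('a)) ^ CARD('a) = ((x ^ CARD('a) - x) ^ CARD('a)) ^ CHAR('a)"
      by (simp only: power_mult[symmetric] mult.commute)
    thus ?thesis
      by (simp only: F frob power_mult_distrib C)
  qed
  define Z where "Z = {x. F x = 0}"
  have "map_poly to_ac f \<noteq> 0"
    using assms(3) by (simp add: map_poly_eq_0_iff)
  hence "finite Z"
    unfolding Z_def F_def by (rule poly_roots_finite)
  moreover have "x ^ CARD('a) \<in> Z" if "x \<in> Z" for x
    using that finite_UNIV_card_ge_0[where ?'a = 'a] by (simp add: Z_def F_frob)
  ultimately obtain N where N: "N > 0" "\<And>x k. x \<in> Z \<Longrightarrow> x \<in> ext_field (N * k)"
    using ext_field_period[OF card_eq] by blast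
  have "Suc (N * k) \<in> bij_degrees f" for k
  proof -
    let ?L = "ext_field (Suc (N * k)) :: 'a alg_closure set"
    have "inj_on F ?L"
    proof (rule inj_onI)
      fix x y assume xy: "x \<in> ?L" "y \<in> ?L" "F x = F y"
      define z where "z = x - y"
      \<comment> \<open>Being fixed at the consecutive exponents \<open>N * k\<close> and
        \<open>Suc (N * k)\<close> forces z^q = z; on such z the map \<open>F\<close> is the
        identity, so z = 0.\<close>
      have "z ^ (CARD('a) ^ (N * k)) = z" "z ^ (CARD('a) ^ Suc (N * k)) = z" "F z = 0"
        using xy N(2)[of z k] ext_field_diff[OF card_eq xy(1,2)]
        by (simp_all add: Z_def z_def F_diff ext_field_def)
      hence "z ^ CARD('a) = z"
        by (metis power_Suc2 power_mult)
      thus "x = y"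
        using \<open>F z = 0\<close> finite_imp_CHAR_pos[where ?'a = 'a] by (simp add: F z_def power_0_left)
    qed
    moreover have "C \<in> ?L"
      using range_to_ac_subset_ext_field by (auto simp: C_def)
    hence "F ` ?L \<subseteq> ?L"
      by (auto simp: F intro!: ext_field_plus[OF card_eq] ext_field_mult ext_field_power[OF card_eq]
            ext_field_diff[OF card_eq])
    ultimately have "bij_betw F ?L ?L"
      by (simp add: bij_betw_def endo_inj_surj finite_ext_field[OF card_eq])
    thus ?thesis
      by (simp add: bij_degrees_def F_def)
  qed
  hence "range (\<lambda>k. Suc (N * k)) \<subseteq> bij_degrees f"
    by auto
  moreover have "infinite (range (\<lambda>k. Suc (N * k)))"
    using N(1) by (intro range_inj_infinite) (simp add: inj_def)
  ultimately show ?thesis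
    unfolding exceptional_def using infinite_super by blast
qed

text \<open>As f' = 1, the difference f - T is a p-th power h^p, and h vanishes on F_q. If h had
  degree q, then f would be of the exceptional additive form.\<close>

lemma degree_nu_polys_ge:
  assumes card_eq: "CARD('a::finite_field) = CHAR('a) ^ n" and "n > 0"
    and f: "f \<in> nu_polys TYPE('a)"
  shows "degree f \<ge> CHAR('a) * (CARD('a) + 1)"
proof -
  have f': "pderiv f = 1" "\<And>a. poly f a = a" "\<not> exceptional f"
    using f by (auto simp: nu_polys_def)
  have "pderiv (f - [:0, 1:]) = 0"
    by (simp add: pderiv_diff f' pderiv_pCons one_pCons)
  then obtain h where "f - [:0, 1:] = h ^ CHAR('a)"
    using poly_CHAR_power_root[OF card_eq assms(2)] by blast
  hence h: "f = [:0, 1:] + h ^ CHAR('a)"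
    by (simp add: algebra_simps)
  have p: "CHAR('a) \<ge> 2"
    using prime_CHAR_finite_field by (rule prime_ge_2_nat)
  have "f \<noteq> 0"
    using f'(1) by auto
  hence not: "h ^ CHAR('a) \<noteq> smult c ((monom 1 (CARD('a)) - [:0, 1:]) ^ CHAR('a))" for c
    using exceptional_additive[OF card_eq, of c] f'(3) h by metis
  \<comment> \<open>The case c = 0: the polynomial T itself is exceptional.\<close>
  have h0: "h \<noteq> 0"
    using not[of 0] p by (auto simp: power_0_left)
  have root: "poly h a = 0" for a
    using f'(2)[of a] p by (simp add: h)
  have "degree h \<noteq> CARD('a)"
    using vanishing_poly_degree(2)[OF root h0] not by (metis smult_power)
  hence deg: "degree h \<ge> CARD('a) + 1"
    using vanishing_poly_degree(1)[OF root h0] by simp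
  have "degree (h ^ CHAR('a)) = CHAR('a) * degree h"
    by (simp add: degree_power_eq h0)
  moreover have "degree [:0, 1 :: 'a:] < CHAR('a) * degree h"
    using mult_le_mono[OF p deg] by simp
  ultimately have "degree f = CHAR('a) * degree h"
    unfolding h by (subst degree_add_eq_right) simp_all
  thus ?thesis
    using mult_le_mono2[OF deg] by (simp only:)
qed

section \<open>The witness, and odd characteristic\<close>

definition witness_poly :: "'a::finite_field poly" where
  "witness_poly = [:0, 1:] + ((monom 1 (CARD('a)) - [:0, 1:]) * [:0, 1:]) ^ CHAR('a)"

lemma poly_witness_poly:
  fixes x :: "'a::finite_field alg_closure"
  shows "poly (map_poly to_ac witness_poly) x = x + ((x ^ CARD('a) - x) * x) ^ CHAR('a)"
  by (simp add: witness_poly_def poly_map_poly_to_ac mult.commute)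

lemma degree_witness_poly:
  "degree (witness_poly :: 'a::finite_field poly) = CHAR('a) * (CARD('a) + 1)"
proof -
  let ?V = "(monom 1 (CARD('a)) - [:0, 1:]) * [:0, 1 :: 'a:]"
  have "degree (monom 1 (CARD('a)) - [:0, 1 :: 'a:]) = CARD('a)"
    by (rule degree_monom_card_minus_X)
  moreover from this have "monom 1 (CARD('a)) - [:0, 1 :: 'a:] \<noteq> 0"
    using card_finite_field_ge_2[where ?'a = 'a] by (metis degree_0 not_numeral_le_zero)
  ultimately have "degree ?V = CARD('a) + 1"
    by (subst degree_mult_eq) simp_all
  hence V: "degree (?V ^ CHAR('a)) = CHAR('a) * (CARD('a) + 1)"
    by (subst degree_power_eq) auto
  have "2 * 1 \<le> CHAR('a) * (CARD('a) + 1)"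
    using prime_ge_2_nat[OF prime_CHAR_finite_field[where ?'a = 'a]] by (intro mult_le_mono) simp_all
  hence "degree [:0, 1 :: 'a:] < degree (?V ^ CHAR('a))"
    unfolding V by simp
  thus ?thesis
    unfolding witness_poly_def by (simp only: degree_add_eq_right V)
qed

lemma pderiv_witness_poly: "pderiv (witness_poly :: 'a::finite_field poly) = 1"
proof -
  have "pderiv (h ^ CHAR('a)) = 0" for h :: "'a poly"
    by (simp add: pderiv_power)
  thus ?thesis
    by (simp add: witness_poly_def pderiv_add pderiv_pCons one_pCons)
qed

lemma poly_witness_poly_base: "poly witness_poly a = (a :: 'a::finite_field)"
  using finite_imp_CHAR_pos[where ?'a = 'a]
  by (simp add: witness_poly_def poly_monom finite_field_power_card_eq_same power_0_left)

context
  fixes n :: nat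
  assumes card_eq: "CARD('a::finite_field) = CHAR('a) ^ n"
begin

text \<open>When x moves to x + z, the bracket (x^q - x) x changes by z times the left side of
  \<open>eq\<close>, hence by w. Its p-th power changes by w^p = -z, which cancels the increment of
  the linear term.\<close>

lemma witness_poly_not_injective:
  fixes w x :: "'a alg_closure"
  assumes "m > 0" "w \<noteq> 0" "w \<in> ext_field m" "x \<in> ext_field m"
  defines "z \<equiv> - (w ^ CHAR('a))"
  assumes eq: "x ^ CARD('a) + (z ^ (CARD('a) - 1) - 2) * x + (z ^ CARD('a) - z) = w / z"
  shows "m \<notin> bij_degrees (witness_poly :: 'a poly)"
proof -
  define F :: "'a alg_closure \<Rightarrow> 'a alg_closure" where "F = poly (map_poly to_ac witness_poly)"
  let ?q = "CARD('a)"
  have z: "z \<noteq> 0" "z \<in> ext_field m"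
    using assms(2,3) ext_field_uminus[OF card_eq] ext_field_power[OF card_eq] by (auto simp: z_def)
  have zq: "z * z ^ (?q - 1) = z ^ ?q"
    using finite_UNIV_card_ge_0[where ?'a = 'a] power_eq_if[of z ?q] by simp
  have "((x + z) ^ ?q - (x + z)) * (x + z) - (x ^ ?q - x) * x =
          z * x ^ ?q + z ^ ?q * x - 2 * z * x + (z ^ ?q - z) * z"
    unfolding frob_add1[OF card_eq] by (simp add: algebra_simps)
  also have "\<dots> = z * (x ^ ?q + (z ^ (?q - 1) - 2) * x + (z ^ ?q - z))"
    unfolding zq[symmetric] by (simp add: algebra_simps)
  also have "\<dots> = w"
    unfolding eq using z by simp
  finally have "(((x + z) ^ ?q - (x + z)) * (x + z)) ^ CHAR('a) - ((x ^ ?q - x) * x) ^ CHAR('a) = - z"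
    unfolding CHAR_power_diff_alg_closure[OF card_eq, symmetric] by (simp add: z_def)
  moreover have "x + z + a = x + b" if "a - b = - z" for a b
    using that by (simp add: algebra_simps)
  ultimately have "F (x + z) = F x"
    unfolding F_def poly_witness_poly by blast
  moreover have "x + z \<noteq> x"
    using z by simp
  ultimately have "\<not> inj_on F (ext_field m)"
    using assms(4) ext_field_plus[OF card_eq assms(4) z(2)] by (meson inj_onD)
  thus ?thesis
    by (auto simp: bij_degrees_def bij_betw_def F_def)
qed

text \<open>Uses that a nonzero \<open>(q - 1)\<close>-th power has norm \<open>1\<close>.\<close>

lemma exists_not_power_odd:
  assumes "m \<ge> 2" "CHAR('a) \<noteq> 2"
  obtains z :: "'a alg_closure" where "z \<in> ext_field m" "z \<noteq> 0"
    "\<forall>x\<in>ext_field m - {0}. x ^ (CARD('a) - 1) \<noteq> 2 - z ^ (CARD('a) - 1)"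
proof -
  let ?L = "ext_field m :: 'a alg_closure set"
  let ?q = "CARD('a)"
  \<comment> \<open>The norm exponent (q^m - 1) / (q - 1).\<close>
  define N where "N = (\<Sum>i<m. ?q ^ i)"
  have q2: "?q \<ge> 2"
    by (rule card_finite_field_ge_2)
  have qN: "(?q - 1) * N = ?q ^ m - 1"
  proof -
    have "(?q - 1) * (\<Sum>i<m. ?q ^ i) + 1 = ?q ^ m"
    proof (induction m)
      case (Suc m)
      have "?q ^ Suc m = (?q - 1) * ?q ^ m + ?q ^ m"
        using q2 add_mult_distrib[of "?q - 1" 1 "?q ^ m"] by simp
      thus ?case
        using Suc by (simp add: distrib_left)
    qed simp
    thus ?thesis
      by (simp add: N_def)
  qed
  have "(\<Sum>i<2. ?q ^ i) \<le> N"
    unfolding N_def using assms(1) by (intro sum_mono2) auto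
  hence N2: "N \<ge> 2"
    using q2 by (simp add: numeral_2_eq_2)
  \<comment> \<open>Modulo p only the summand i = 0 survives, so the coefficient N choose 1 will not
    vanish below.\<close>
  have "of_nat N = (\<Sum>i<m. (of_nat ?q :: 'a alg_closure) ^ i)"
    by (simp add: N_def)
  also have "of_nat ?q = (0 :: 'a alg_closure)"
    using CHAR_dvd_CARD[where ?'a = 'a] by (simp only: of_nat_eq_0_iff_char_dvd CHAR_alg_closure)
  finally have of_N: "of_nat N = (1 :: 'a alg_closure)"
    using assms(1) by (simp add: power_0_left)
  have two: "2 \<noteq> (0 :: 'a alg_closure)"
  proof
    assume "2 = (0 :: 'a alg_closure)"
    hence "CHAR('a) dvd 2"
      using of_nat_eq_0_iff_char_dvd[where ?'a = "'a alg_closure", of 2] by simp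
    thus False
      using assms(2) prime_CHAR_finite_field[where ?'a = 'a] primes_dvd_imp_eq two_is_prime_nat by blast
  qed
  have "\<exists>z\<in>?L - {0}. (2 - z ^ (?q - 1)) ^ N \<noteq> 1"
  proof (rule ccontr)
    assume "\<not> ?thesis"
    hence *: "(2 - z ^ (?q - 1)) ^ N = 1" if "z \<in> ?L" "z \<noteq> 0" for z
      using that by blast
    \<comment> \<open>Chosen so that the exponents of the expansion become (q - 1) (N - 1 + k),
      where only k = 1 gives a multiple of q^m - 1. Being positive, \<open>e\<close> also kills the
      point z = 0.\<close>
    define e where "e = (?q - 1) * (N - 1)"
    have "e > 0" "e < ?q ^ m - 1"
      unfolding qN[symmetric] using q2 N2 by (simp_all add: e_def)
    hence "0 = (\<Sum>z\<in>?L. z ^ e)"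
      using assms(1) by (subst power_sum_ext_field[OF card_eq]) (auto dest: dvd_imp_le)
    also have "\<dots> = (\<Sum>z\<in>?L. z ^ e * (- (z ^ (?q - 1)) + 2) ^ N)"
      using * \<open>e > 0\<close> by (intro sum.cong) (auto simp: power_0_left)
    also have "\<dots> = (\<Sum>z\<in>?L. \<Sum>k\<le>N. of_nat (N choose k) * (-1) ^ k * 2 ^ (N - k) * z ^ (e + (?q - 1) * k))"
    proof (intro sum.cong refl)
      fix z :: "'a alg_closure"
      have "(- (z ^ (?q - 1))) ^ k = (-1) ^ k * z ^ ((?q - 1) * k)" for k
        unfolding power_mult by (rule power_minus)
      thus "z ^ e * (- (z ^ (?q - 1)) + 2) ^ N =
          (\<Sum>k\<le>N. of_nat (N choose k) * (-1) ^ k * 2 ^ (N - k) * z ^ (e + (?q - 1) * k))"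
        unfolding binomial_ring sum_distrib_left
        by (intro sum.cong refl) (simp only: power_add mult_ac)
    qed
    also have "\<dots> = (\<Sum>k\<le>N. of_nat (N choose k) * (-1) ^ k * 2 ^ (N - k) * (\<Sum>z\<in>?L. z ^ (e + (?q - 1) * k)))"
      by (subst sum.swap) (simp add: sum_distrib_left)
    also have "\<dots> = (\<Sum>k\<le>N. if k = 1 then of_nat N * 2 ^ (N - 1) else 0)"
    proof (intro sum.cong refl)
      fix k assume "k \<in> {..N}"
      have "e + (?q - 1) * k = (?q - 1) * (N - 1 + k)"
        by (simp add: e_def distrib_left)
      hence "?q ^ m - 1 dvd e + (?q - 1) * k \<longleftrightarrow> N dvd N - 1 + k"
        unfolding qN[symmetric] using q2 by simp
      also have "\<dots> \<longleftrightarrow> k = 1"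
      proof
        assume "N dvd N - 1 + k"
        then obtain j where j: "N - 1 + k = N * j"
          by blast
        \<comment> \<open>As k is at most N, the multiple N - 1 + k of N lies strictly between 0 and
          2 N.\<close>
        have "N * j < N * 2" "N * j > 0"
          unfolding j[symmetric] using \<open>k \<in> {..N}\<close> N2 by auto
        hence "j = 1"
          by simp
        thus "k = 1"
          using j N2 by simp
      qed (use N2 in simp)
      finally show "of_nat (N choose k) * (-1) ^ k * 2 ^ (N - k) * (\<Sum>z\<in>?L. z ^ (e + (?q - 1) * k)) =
          (if k = 1 then of_nat N * 2 ^ (N - 1) else 0)"
        using assms(1) \<open>e > 0\<close> by (subst power_sum_ext_field[OF card_eq]) auto
    qed
    also have "\<dots> = 2 ^ (N - 1)"
      using N2 by (simp add: of_N)
    finally show False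
      using two by simp
  qed
  then obtain z where z: "z \<in> ?L" "z \<noteq> 0" "(2 - z ^ (?q - 1)) ^ N \<noteq> 1"
    by blast
  show ?thesis
  proof (rule that[OF z(1,2)], rule ballI)
    fix x assume "x \<in> ?L - {0}"
    hence "(x ^ (?q - 1)) ^ N = 1"
      using ext_field_power_card_minus_1[OF card_eq, of x m] qN by (simp flip: power_mult)
    thus "x ^ (?q - 1) \<noteq> 2 - z ^ (?q - 1)"
      using z(3) by auto
  qed
qed

lemma CHAR_root_ext_field:
  assumes "z \<in> (ext_field m :: 'a alg_closure set)" "m > 0"
  obtains w where "w \<in> ext_field m" "w ^ CHAR('a) = z"
proof -
  have "inj_on (\<lambda>w. w ^ CHAR('a)) (ext_field m :: 'a alg_closure set)"
    using CHAR_power_diff_alg_closure[OF card_eq] by (intro inj_onI) (metis right_minus_eq power_eq_0_iff)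
  hence "(\<lambda>w. w ^ CHAR('a)) ` ext_field m = (ext_field m :: 'a alg_closure set)"
    by (intro endo_inj_surj) (auto simp: finite_ext_field[OF card_eq] assms(2) ext_field_power[OF card_eq])
  thus ?thesis
    using assms(1) that by (metis (no_types, lifting) imageE)
qed

text \<open>With z from \<open>exists_not_power_odd\<close> the additive map \<open>T\<close> has
  trivial kernel: a nonzero u in it would satisfy u^(q-1) = 2 - z^(q-1). Injective on a finite
  field, it is onto, so the collision equation is solvable for x.\<close>

lemma witness_poly_odd:
  assumes "CHAR('a) \<noteq> 2" "m \<ge> 2"
  shows "m \<notin> bij_degrees (witness_poly :: 'a poly)"
proof -
  let ?L = "ext_field m :: 'a alg_closure set"
  let ?q = "CARD('a)"
  obtain z :: "'a alg_closure" where z: "z \<in> ?L" "z \<noteq> 0"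
    "\<forall>x\<in>?L - {0}. x ^ (?q - 1) \<noteq> 2 - z ^ (?q - 1)"
    using exists_not_power_odd[OF assms(2,1)] by blast
  define b where "b = z ^ (?q - 1) - 2"
  define T where "T = (\<lambda>x :: 'a alg_closure. x ^ ?q + b * x)"
  obtain w where w: "w \<in> ?L" "w ^ CHAR('a) = - z"
    using CHAR_root_ext_field[of "- z" m] z(1) ext_field_uminus[OF card_eq] assms(2) by auto
  have zw: "z = - (w ^ CHAR('a))"
    by (simp add: w(2))
  have w0: "w \<noteq> 0"
    using z(2) zw finite_imp_CHAR_pos[where ?'a = 'a] by (auto simp: power_0_left)
  have two: "2 \<in> ?L"
    using ext_field_plus[OF card_eq, of 1 m 1] one_in_ext_field[OF card_eq] by simp
  have b: "b \<in> ?L"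
    using z(1) two by (simp add: b_def ext_field_diff[OF card_eq] ext_field_power[OF card_eq])
  have "inj_on T ?L"
  proof (rule inj_onI, rule ccontr)
    fix x y assume xy: "x \<in> ?L" "y \<in> ?L" "T x = T y" "x \<noteq> y"
    define u where "u = x - y"
    have "u \<in> ?L" "u \<noteq> 0"
      using xy ext_field_diff[OF card_eq] by (simp_all add: u_def)
    moreover have "u * (u ^ (?q - 1) + b) = 0"
    proof -
      have eq: "u * u ^ (?q - 1) = x ^ ?q - y ^ ?q"
        using finite_UNIV_card_ge_0[where ?'a = 'a] power_eq_if[of u ?q] frob_diff1[OF card_eq, of x y]
        by (simp add: u_def)
      have "u * (u ^ (?q - 1) + b) = u * u ^ (?q - 1) + b * u"
        by (simp add: algebra_simps)
      also have "\<dots> = T x - T y"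
        unfolding eq by (simp add: T_def u_def algebra_simps)
      finally show ?thesis
        using xy(3) by simp
    qed
    ultimately have "u ^ (?q - 1) + b = 0" "u ^ (?q - 1) \<noteq> 2 - z ^ (?q - 1)"
      using z(3) by auto
    thus False
      by (simp only: b_def add_eq_0_iff2 minus_diff_eq simp_thms)
  qed
  moreover have "T ` ?L \<subseteq> ?L"
    using b by (auto simp: T_def ext_field_plus[OF card_eq] ext_field_power[OF card_eq] ext_field_mult)
  ultimately have "T ` ?L = ?L"
    using assms(2) by (intro endo_inj_surj) (auto simp: finite_ext_field[OF card_eq])
  moreover have "w / z - (z ^ ?q - z) \<in> ?L"
    using w(1) z(1)
    by (intro ext_field_diff[OF card_eq] ext_field_power[OF card_eq] ext_field_divide[OF card_eq])
  ultimately obtain x where "x \<in> ?L" "T x = w / z - (z ^ ?q - z)"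
    by (metis imageE)
  thus ?thesis
    using assms(2) w0 w(1) unfolding zw
    by (intro witness_poly_not_injective[of m w x]) (simp_all add: T_def b_def algebra_simps zw)
qed

end

section \<open>Sums of few powers of two modulo a Mersenne number\<close>

text \<open>Since 2^K is 1 modulo 2^K - 1, doubling rotates the K binary places; a carry out of the
  top re-enters at 0.\<close>

lemma cong_power2_rotate:
  assumes "b < K"
  shows "[2 ^ (Suc b mod K) = 2 * 2 ^ b] (mod (2 ^ K - 1 :: nat))"
proof (cases "Suc b = K")
  case True
  have "(2 :: nat) ^ K = 1 + (2 ^ K - 1)"
    by simp
  hence "[1 = 2 ^ K] (mod (2 ^ K - 1 :: nat))"
    by (metis cong_def mod_add_self2)
  thus ?thesis
    using True by (simp flip: power_Suc)
next
  case False
  thus ?thesis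
    using assms by simp
qed

lemma set_encode_lessThan: "set_encode {..<K} = 2 ^ K - 1"
  using sum_power2[of K] by (simp add: set_encode_def atLeast0LessThan)

text \<open>A repeated place can be carried to the next one, which keeps the residue and lowers the
  size; by induction the result would be \<open>mset_set B\<close>, for which it is too small. So no
  place repeats and binary expansion decides. The only colliding encodings, 0 and 2^K - 1, are
  excluded because \<open>B\<close> is nonempty and proper.\<close>

lemma power2_sum_mset_unique:
  assumes "set_mset M \<subseteq> {..<K}" "B \<subset> {..<K}" "B \<noteq> {}" "size M \<le> card B"
    and "[(\<Sum>b\<in>#M. 2 ^ b) = set_encode B] (mod (2 ^ K - 1))"
  shows "M = mset_set B"
  using assms(1,4,5)
proof (induction "size M" arbitrary: M rule: less_induct)
  case (less M)
  have fin: "finite B"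
    using assms(2) finite_subset by blast
  show ?case
  proof (cases "\<exists>b. count M b \<ge> 2")
    case True
    then obtain b where "replicate_mset 2 b \<subseteq># M"
      by (auto simp: count_le_replicate_mset_subset_eq)
    then obtain M' where "M = replicate_mset 2 b + M'"
      using subset_mset.le_iff_add by auto
    hence M: "M = {#b, b#} + M'"
      by (simp add: numeral_2_eq_2)
    define M'' where "M'' = add_mset (Suc b mod K) M'"
    have b: "b < K"
      using less.prems(1) M by auto
    have "[(\<Sum>b\<in>#M''. 2 ^ b) = (\<Sum>b\<in>#M. 2 ^ b)] (mod (2 ^ K - 1 :: nat))"
      using cong_add[OF cong_power2_rotate[OF b] cong_refl] by (simp add: M M''_def mult_2 add.assoc)
    hence "M'' = mset_set B"
      using less.prems b
      by (intro less.hyps) (auto simp: M M''_def intro: cong_trans)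
    moreover have "size M'' < card B"
      using less.prems(2) by (simp add: M M''_def)
    ultimately show ?thesis
      by simp
  next
    case False
    define A where "A = set_mset M"
    have "count M b = count (mset_set A) b" for b
    proof (cases "b \<in># M")
      case True
      moreover have "count M b < 2"
        using False not_le by blast
      ultimately have "count M b = 1"
        using count_greater_zero_iff[of M b] by linarith
      thus ?thesis
        using True by (simp add: A_def)
    next
      case False
      thus ?thesis
        by (simp add: A_def not_in_iff)
    qed
    hence M: "M = mset_set A"
      by (rule multiset_eqI)
    have A: "finite A" "A \<subseteq> {..<K}"
      using less.prems(1) by (simp_all add: A_def)
    have mono: "set_encode C \<le> 2 ^ K - 1" if "C \<subseteq> {..<K}" for C
      unfolding set_encode_lessThan[symmetric] set_encode_def
      using that by (intro sum_mono2) auto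
    have "set_encode B \<noteq> 0" "set_encode B \<noteq> 2 ^ K - 1"
      using set_encode_eq[OF fin finite.emptyI] set_encode_eq[OF fin finite_lessThan[of K]] assms(2,3)
      by (auto simp: set_encode_lessThan)
    moreover have "[set_encode A = set_encode B] (mod (2 ^ K - 1))"
      using less.prems(3) by (simp add: M set_encode_def sum_unfold_sum_mset)
    \<comment> \<open>If \<open>A\<close> were all of \<open>{..<K}\<close>, its residue would be 0,
      unlike that of \<open>B\<close>.\<close>
    ultimately have "set_encode A = set_encode B"
      using mono[OF A(2)] mono[OF psubset_imp_subset[OF assms(2)]]
      by (cases "set_encode A = 2 ^ K - 1") (simp_all add: cong_def)
    thus ?thesis
      using set_encode_eq[OF A(1) fin] M by simp
  qed
qed

section \<open>Binary digits of the exponents\<close>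

text \<open>
  Over \<open>F_q\<close> with \<open>q = 2^n\<close> and \<open>K = n * m\<close>, the binary digits of the exponent of one term of
  \<open>(1 + tr (v^(2 * q - 2) + v^(2 * q + 1)))^(2^j)\<close>, as a power of an element \<open>v\<close> of the field with
  \<open>2^K\<close> elements: \<open>None\<close> is the summand \<open>1\<close>, and the pair \<open>(i, t)\<close> selects the \<open>q^i\<close>-th power
  of one of the two summands under the trace.
\<close>

fun digits :: "nat \<Rightarrow> nat \<Rightarrow> nat \<Rightarrow> (nat \<times> bool) option \<Rightarrow> nat multiset" where
  "digits n K j None = {#}"
| "digits n K j (Some (i, True)) = image_mset (\<lambda>k. (j + 1 + n * i + k) mod K) (mset_set {..<n})"
| "digits n K j (Some (i, False)) = {#(j + n * i) mod K, (j + n + 1 + n * i) mod K#}"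

text \<open>Indexes the 2 m + 1 summands of 1 + tr(...).\<close>

definition term_choices :: "nat \<Rightarrow> (nat \<times> bool) option set" where
  "term_choices m = insert None (Some ` ({..<m} \<times> UNIV))"

lemma finite_term_choices [simp]: "finite (term_choices m)"
  by (simp add: term_choices_def)

lemma digits_less: "0 < K \<Longrightarrow> b \<in># digits n K j c \<Longrightarrow> b < K"
  by (cases "(n, K, j, c)" rule: digits.cases) auto

section \<open>Target digit sets and the uniqueness of their decomposition\<close>

lemma set_mset_sum_eq_UN: "finite A \<Longrightarrow> set_mset (\<Sum>j\<in>A. M j) = (\<Union>j\<in>A. set_mset (M j))"
  by (induction A rule: finite_induct) auto

lemma size_sum_multiset:
  fixes M :: "'a \<Rightarrow> 'b multiset"
  shows "size (\<Sum>j\<in>A. M j) = (\<Sum>j\<in>A. size (M j))"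
  by (induction A rule: infinite_finite_induct) auto

lemma sum_mset_set_UN:
  assumes "finite A" "\<And>j. j \<in> A \<Longrightarrow> finite (S j)" "disjoint_family_on S A"
  shows "(\<Sum>j\<in>A. mset_set (S j)) = mset_set (\<Union>j\<in>A. S j)"
  using assms
proof (induction A rule: finite_induct)
  case (insert x A)
  have "S x \<inter> (\<Union>j\<in>A. S j) = {}"
    using insert.hyps insert.prems(2) by (auto simp: disjoint_family_on_def)
  thus ?case
    using insert by (simp add: mset_set_Union disjoint_family_on_insert)
qed simp

text \<open>The binary digits of the sum over j < n of (2 q - 2) q^(2 j) 2^j for q = 2^n: runs of n
  ones, starting at place 1 and separated by gaps of n + 1 zeros.\<close>

definition spaced_runs :: "nat \<Rightarrow> nat set" where
  "spaced_runs n = (\<Union>j<n. (\<lambda>k. Suc ((2 * n + 1) * j + k)) ` {..<n})"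

lemma spaced_runs_iff:
  "b \<in> spaced_runs n \<longleftrightarrow>
     b > 0 \<and> (b - 1) div (2 * n + 1) < n \<and> (b - 1) mod (2 * n + 1) < n"
proof
  assume "b \<in> spaced_runs n"
  thus "b > 0 \<and> (b - 1) div (2 * n + 1) < n \<and> (b - 1) mod (2 * n + 1) < n"
    by (auto simp: spaced_runs_def simp del: mult_Suc)
next
  assume *: "b > 0 \<and> (b - 1) div (2 * n + 1) < n \<and> (b - 1) mod (2 * n + 1) < n"
  hence "b = Suc ((2 * n + 1) * ((b - 1) div (2 * n + 1)) + (b - 1) mod (2 * n + 1))"
    by (simp only: mult_div_mod_eq) simp
  thus "b \<in> spaced_runs n"
    unfolding spaced_runs_def using * by blast
qed

lemma disjoint_spaced_runs:
  "disjoint_family_on (\<lambda>j. (\<lambda>k. Suc ((2 * n + 1) * j + k)) ` {..<n}) {..<n}"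
proof -
  have "j = j'" if "(2 * n + 1) * j + k = (2 * n + 1) * j' + k'" "k < n" "k' < n" for j j' k k' :: nat
  proof -
    have "((2 * n + 1) * j + k) div (2 * n + 1) = j" "((2 * n + 1) * j' + k') div (2 * n + 1) = j'"
      using that(2,3) by (simp_all del: mult_Suc)
    thus ?thesis
      using that(1) by simp
  qed
  thus ?thesis
    unfolding disjoint_family_on_def by (fastforce simp del: mult_Suc)
qed

lemma card_spaced_runs: "card (spaced_runs n) = n * n"
proof -
  have "card (spaced_runs n) = (\<Sum>j<n. card ((\<lambda>k. Suc ((2 * n + 1) * j + k)) ` {..<n}))"
    unfolding spaced_runs_def using disjoint_spaced_runs[of n]
    by (intro card_UN_disjoint) (auto simp: disjoint_family_on_def)
  also have "\<dots> = (\<Sum>j<n. n)"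
    by (intro sum.cong refl, subst card_image) (auto simp: inj_on_def)
  finally show ?thesis
    by simp
qed

text \<open>This margin ensures that a run or pair of digits starting in the set does not wrap
  around modulo n m.\<close>

lemma spaced_runs_less:
  assumes "b \<in> spaced_runs n" "m \<ge> 2 * n + 2"
  shows "b + n + 1 < n * m"
proof -
  obtain j k where b: "b = Suc ((2 * n + 1) * j + k)" "j < n" "k < n"
    using assms(1) by (auto simp: spaced_runs_def)
  have "(2 * n + 1) * j \<le> (2 * n + 1) * (n - 1)"
    using b(2) by (intro mult_le_mono2) simp
  also have "\<dots> + 2 * n + 1 = (2 * n + 1) * n"
    using b(2) by (cases n) simp_all
  hence "(2 * n + 1) * (n - 1) = (2 * n + 1) * n - (2 * n + 1)"
    by simp
  finally have "b + n + 1 \<le> (2 * n + 1) * n - (2 * n + 1) + 2 * n + 1"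
    using b by simp
  also have "\<dots> = (2 * n + 1) * n"
    using b(2) by (cases n) simp_all
  also have "\<dots> < (2 * n + 2) * n"
    using b(2) by simp
  also have "\<dots> \<le> n * m"
    using mult_le_mono2[OF assms(2), of n] by (simp only: mult.commute)
  finally show ?thesis .
qed

text \<open>Two digits at distance n + 1 never fit, because such a shift leads from a run into a
  gap. A block of n consecutive digits must fill a whole run, and the residue of its start modulo n
  reveals which one.\<close>

lemma digits_subset_spaced_runs:
  assumes "n \<ge> 2" "m \<ge> 2 * n + 2" "j < n" "c \<in> term_choices m"
    and "set_mset (digits n (n * m) j c) \<subseteq> spaced_runs n" "c \<noteq> None"
  shows "c = Some (2 * j, True)"
proof -
  let ?K = "n * m"
  let ?N = "2 * n + 1"
  obtain i t where c: "c = Some (i, t)" "i < m"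
    using assms(4,6) by (auto simp: term_choices_def)
  have shift: "(a + d) mod ?K = a mod ?K + d" if "a mod ?K \<in> spaced_runs n" "d \<le> n + 1" for a d
  proof -
    have "a mod ?K + d < ?K"
      using spaced_runs_less[OF that(1) assms(2)] that(2) by linarith
    thus ?thesis
      by (metis mod_add_left_eq mod_less)
  qed
  show ?thesis
  proof (cases t)
    case False
    define a where "a = (j + n * i) mod ?K"
    have a: "a \<in> spaced_runs n"
      using assms(5) False by (auto simp: c a_def)
    moreover have "a + (n + 1) \<in> spaced_runs n"
      using assms(5) False shift[of "j + n * i" "n + 1"] a by (auto simp: c a_def ac_simps)
    ultimately have "a > 0" "(a - 1) mod ?N < n" "(a - 1 + (n + 1)) mod ?N < n"
      by (simp_all add: spaced_runs_iff)
    \<comment> \<open>The shifted residue is at least n + 1, hence in the gap.\<close>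
    moreover have "(a - 1 + (n + 1)) mod ?N = (a - 1) mod ?N + (n + 1)"
    proof -
      have "(a - 1) mod ?N + (n + 1) < ?N"
        using \<open>(a - 1) mod ?N < n\<close> by linarith
      thus ?thesis
        by (metis mod_add_left_eq mod_less)
    qed
    ultimately show ?thesis
      by linarith
  next
    case True
    define a where "a = (j + 1 + n * i) mod ?K"
    have mem: "(j + 1 + n * i + k) mod ?K \<in> spaced_runs n" if "k < n" for k
      using assms(5) True that by (auto simp: c)
    have a: "a \<in> spaced_runs n"
      using mem[of 0] assms(1) by (simp add: a_def)
    have "a + (n - 1) \<in> spaced_runs n"
      using mem[of "n - 1"] shift[of "j + 1 + n * i" "n - 1"] a assms(1) by (simp add: a_def)
    hence *: "a > 0" "(a - 1) mod ?N < n" "(a - 1) div ?N < n" "(a - 1 + (n - 1)) mod ?N < n"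
      using a by (simp_all add: spaced_runs_iff)
    have "(a - 1) mod ?N + (n - 1) < ?N"
      using *(2) by linarith
    hence "(a - 1 + (n - 1)) mod ?N = (a - 1) mod ?N + (n - 1)"
      by (metis mod_add_left_eq mod_less)
    \<comment> \<open>Residues r and r + n - 1 are both below n only for r = 0.\<close>
    hence "(a - 1) mod ?N = 0"
      using *(4) by linarith
    define j' where "j' = (a - 1) div ?N"
    have j': "j' < n" "a = 1 + ?N * j'"
      using *(1,3) \<open>(a - 1) mod ?N = 0\<close> mult_div_mod_eq[of ?N "a - 1"] by (simp_all add: j'_def)
    have "(j + 1 + n * i) mod n = (1 + ?N * j') mod n"
      unfolding j'(2)[symmetric] a_def by (simp add: mod_mod_cancel)
    hence "(j + 1) mod n = (1 + j' + n * (2 * j')) mod n"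
      by (simp add: algebra_simps)
    hence "[j + 1 = j' + 1] (mod n)"
      by (simp add: cong_def)
    hence "[j = j'] (mod n)"
      using cong_add_rcancel_nat by blast
    hence "j = j'"
      using j'(1) assms(3) by (simp add: cong_def)
    \<comment> \<open>Excludes wrap-around: the start is at most n m, and equality would give a =
      0.\<close>
    have "n * i \<le> n * (m - 1)"
      using c(2) by (intro mult_le_mono2) simp
    moreover have "n * (m - 1) + n = ?K"
      using c(2) by (cases m) simp_all
    ultimately have "j + 1 + n * i \<le> ?K"
      using assms(3) by linarith
    moreover have "j + 1 + n * i \<noteq> ?K"
      using *(1) by (auto simp: a_def)
    ultimately have "j + 1 + n * i = 1 + ?N * j"
      using j'(2) by (simp add: a_def \<open>j = j'\<close>)
    hence "n * i = n * (2 * j)"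
      by (simp add: algebra_simps)
    hence "i = 2 * j"
      using assms(1) by simp
    thus ?thesis
      using True by (simp add: c)
  qed
qed

text \<open>A pair has two digits, so n = 1 fails here and gets its own target set in
  \<open>digits_one_unique\<close>.\<close>

lemma size_digits_le: "n \<ge> 2 \<Longrightarrow> size (digits n K j c) \<le> n"
  by (cases "(n, K, j, c)" rule: digits.cases) auto

text \<open>The target has n * n digits, the most that n factors can supply. Hence no factor is
  \<open>None\<close>, and each is determined by \<open>digits_subset_spaced_runs\<close>.\<close>

lemma digits_spaced_runs_unique:
  assumes "n \<ge> 2" "m \<ge> 2 * n + 2" "\<phi> \<in> (\<Pi>\<^sub>E j\<in>{..<n}. term_choices m)"
  shows "(\<Sum>j<n. digits n (n * m) j (\<phi> j)) = mset_set (spaced_runs n) \<longleftrightarrow>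
           \<phi> = (\<lambda>j\<in>{..<n}. Some (2 * j, True))"
proof
  have fin: "finite (spaced_runs n)"
    by (simp add: spaced_runs_def)
  assume eq: "(\<Sum>j<n. digits n (n * m) j (\<phi> j)) = mset_set (spaced_runs n)"
  have "\<phi> j = Some (2 * j, True)" if j: "j < n" for j
  proof (rule digits_subset_spaced_runs[OF assms(1,2) j])
    show "\<phi> j \<in> term_choices m"
      using assms(3) j by auto
    show "set_mset (digits n (n * m) j (\<phi> j)) \<subseteq> spaced_runs n"
      using arg_cong[OF eq, of set_mset] j fin by (auto simp: set_mset_sum_eq_UN)
    show "\<phi> j \<noteq> None"
    proof
      assume None: "\<phi> j = None"
      have "n * n = (\<Sum>j<n. size (digits n (n * m) j (\<phi> j)))"
        using arg_cong[OF eq, of size] by (simp add: size_sum_multiset card_spaced_runs)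
      also have "\<dots> < (\<Sum>j<n. n)"
        using size_digits_le[OF assms(1)] j None assms(1)
        by (intro sum_strict_mono_ex1) (auto intro!: bexI[of _ j])
      finally show False
        by simp
    qed
  qed
  thus "\<phi> = (\<lambda>j\<in>{..<n}. Some (2 * j, True))"
    using assms(3) by (intro extensionalityI[of \<phi> "{..<n}"]) (auto simp: PiE_def)
next
  assume \<phi>: "\<phi> = (\<lambda>j\<in>{..<n}. Some (2 * j, True))"
  have "(\<Sum>j<n. digits n (n * m) j (\<phi> j)) =
          (\<Sum>j<n. mset_set ((\<lambda>k. Suc ((2 * n + 1) * j + k)) ` {..<n}))"
  proof (intro sum.cong refl)
    fix j assume j: "j \<in> {..<n}"
    have "Suc ((2 * n + 1) * j + k) < n * m" if "k < n" for k
    proof -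
      have "Suc ((2 * n + 1) * j + k) \<in> spaced_runs n"
        using j that unfolding spaced_runs_def by blast
      from spaced_runs_less[OF this assms(2)] show ?thesis
        by linarith
    qed
    hence "digits n (n * m) j (\<phi> j) = image_mset (\<lambda>k. Suc ((2 * n + 1) * j + k)) (mset_set {..<n})"
      using j by (auto simp: \<phi> algebra_simps intro!: image_mset_cong)
    also have "\<dots> = mset_set ((\<lambda>k. Suc ((2 * n + 1) * j + k)) ` {..<n})"
      by (rule image_mset_mset_set) (simp add: inj_on_def)
    finally show "digits n (n * m) j (\<phi> j) = mset_set ((\<lambda>k. Suc ((2 * n + 1) * j + k)) ` {..<n})" .
  qed
  also have "\<dots> = mset_set (spaced_runs n)"
    unfolding spaced_runs_def by (intro sum_mset_set_UN disjoint_spaced_runs) auto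
  finally show "(\<Sum>j<n. digits n (n * m) j (\<phi> j)) = mset_set (spaced_runs n)" .
qed

text \<open>For q = 2 the target is the exponent 2 q + 1 = 5, with digits 0 and 2.\<close>

lemma digits_one_unique:
  assumes "m > 4" "\<phi> \<in> (\<Pi>\<^sub>E j\<in>{..<1}. term_choices m)"
  shows "(\<Sum>j<1. digits 1 (1 * m) j (\<phi> j)) = mset_set {0, 2} \<longleftrightarrow>
           \<phi> = (\<lambda>j\<in>{..<1}. Some (0, False))"
proof
  assume eq: "(\<Sum>j<1. digits 1 (1 * m) j (\<phi> j)) = mset_set {0, 2}"
  hence eq': "digits 1 m 0 (\<phi> 0) = {#0, 2#}"
    by (simp add: lessThan_Suc)
  have "\<phi> 0 \<in> term_choices m"
    using assms(2) by auto
  hence "\<phi> 0 = None \<or> (\<exists>i. \<phi> 0 = Some (i, True)) \<or> (\<exists>i<m. \<phi> 0 = Some (i, False))"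
    by (auto simp: term_choices_def)
  then consider "\<phi> 0 = None" | i where "\<phi> 0 = Some (i, True)" | i where "\<phi> 0 = Some (i, False)" "i < m"
    by fast
  hence "\<phi> 0 = Some (0, False)"
  proof cases
    case 2
    thus ?thesis
      using arg_cong[OF eq', of size] by simp
  next
    case 3
    hence "{i mod m, (2 + i) mod m} = {0, 2}"
      using arg_cong[OF eq', of set_mset] by simp
    \<comment> \<open>The alternative i = 2 needs the place 4 to wrap to 0, which m > 4
      prevents.\<close>
    hence "i = 0 \<or> i = 2 \<and> 4 mod m = 0"
      using 3(2) by (auto simp: doubleton_eq_iff)
    thus ?thesis
      using 3 assms(1) by auto
  qed (use eq' in simp)
  thus "\<phi> = (\<lambda>j\<in>{..<1}. Some (0, False))"
    using assms(2) by (intro extensionalityI[of \<phi> "{..<1}"]) (auto simp: PiE_def)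
next
  assume "\<phi> = (\<lambda>j\<in>{..<1}. Some (0, False))"
  thus "(\<Sum>j<1. digits 1 (1 * m) j (\<phi> j)) = mset_set {0, 2}"
    using assms(1) by (simp add: numeral_2_eq_2)
qed

section \<open>Characteristic two\<close>

definition trace :: "nat \<Rightarrow> 'a::finite_field alg_closure \<Rightarrow> 'a alg_closure" where
  "trace m y = (\<Sum>i<m. y ^ (CARD('a) ^ i))"

lemma trace_one: "trace m 1 = (of_nat m :: 'a::finite_field alg_closure)"
  by (simp add: trace_def)

context
  fixes n :: nat
  assumes card_eq: "CARD('a::finite_field) = CHAR('a) ^ n"
begin

lemma trace_add:
  fixes x y :: "'a alg_closure"
  shows "trace m (x + y) = trace m x + trace m y"
  by (simp add: trace_def frob_add[OF card_eq] sum.distrib)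

lemma trace_frob:
  fixes y :: "'a alg_closure"
  assumes "y \<in> ext_field m"
  shows "trace m y ^ CARD('a) = trace m y"
proof -
  have "trace m y ^ CARD('a) = (\<Sum>i<m. y ^ (CARD('a) ^ Suc i))"
    by (simp add: trace_def frob_sum1[OF card_eq] mult.commute flip: power_mult)
  also have "\<dots> + y = (\<Sum>i<Suc m. y ^ (CARD('a) ^ i))"
    by (subst sum.lessThan_Suc_shift) simp
  also have "\<dots> = trace m y + y"
    using assms by (simp add: trace_def ext_field_def)
  finally show ?thesis
    by simp
qed

text \<open>Additive Hilbert 90, with \<open>1\<close> in the role of the auxiliary element of nonzero trace.\<close>

lemma trace_zero_imp_frob_diff:
  fixes y :: "'a alg_closure"
  assumes "y \<in> ext_field m" "trace m y = 0"
  obtains s where "s \<in> ext_field m" "s - s ^ CARD('a) = of_nat m * y"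
proof -
  \<comment> \<open>Partial traces: Frobenius sends \<open>S i\<close> to
    \<open>S (Suc i) - y\<close>, so s - s^q telescopes to m y + S 0 - S m.\<close>
  define S where "S = (\<lambda>i. \<Sum>k<Suc i. y ^ (CARD('a) ^ k))"
  define s where "s = (\<Sum>i<m. S i)"
  have S_frob: "S i ^ CARD('a) = S (Suc i) - y" for i
  proof -
    have "S i ^ CARD('a) = (\<Sum>k<Suc i. y ^ (CARD('a) ^ Suc k))"
      unfolding S_def frob_sum1[OF card_eq] by (simp add: mult.commute flip: power_mult)
    also have "\<dots> + y = S (Suc i)"
      unfolding S_def by (subst (2) sum.lessThan_Suc_shift) simp
    finally show ?thesis
      by (simp add: algebra_simps)
  qed
  have "S m = trace m y + y ^ (CARD('a) ^ m)"
    by (simp add: S_def trace_def)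
  hence "S m = S 0"
    using assms by (simp add: S_def ext_field_def)
  have "(\<Sum>i<m. S (Suc i)) + S 0 = s + S m"
    unfolding s_def using sum.lessThan_Suc_shift[of S m] by (simp add: add.commute)
  moreover have "s ^ CARD('a) = (\<Sum>i<m. S (Suc i)) - of_nat m * y"
    by (simp add: s_def frob_sum1[OF card_eq] S_frob sum_subtractf)
  ultimately have "s - s ^ CARD('a) = of_nat m * y"
    using \<open>S m = S 0\<close> by (simp add: algebra_simps)
  moreover have "s \<in> ext_field m"
    unfolding s_def S_def
    by (intro ext_field_sum[OF card_eq] ext_field_power[OF card_eq] assms(1))
  ultimately show ?thesis
    using that by blast
qed

lemma ext_field_power_iterate:
  fixes x :: "'a alg_closure"
  assumes "x \<in> ext_field m"
  shows "x ^ ((CARD('a) ^ m) ^ t) = x"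
  by (induction t) (use assms in \<open>simp_all add: power_mult ext_field_def\<close>)

end

section \<open>Nonexceptionality of the witness for even q\<close>

context
  fixes n :: nat
  assumes card_eq: "CARD('a::finite_field) = CHAR('a) ^ n" and char2: "CHAR('a) = 2"
    and n_pos: "n > 0"
begin

private lemma card_2: "CARD('a) = 2 ^ n"
  using card_eq char2 by simp

private lemma two_zero: "2 = (0 :: 'a alg_closure)"
  using two_eq_0_alg_closure[OF char2] .

private lemma double_zero: "x + x = (0 :: 'a alg_closure)"
  using two_zero mult_2[of x] by simp

private lemma neg_self: "- x = (x :: 'a alg_closure)"
  using double_zero[of x] by (simp add: eq_neg_iff_add_eq_0)

text \<open>Any root in the closure satisfies s^q = 1 + s, so applying Frobenius twice returns s; it
  lies in F_{q^2}, inside F_{q^m} for even m.\<close>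

lemma frob_add_eq_1_even:
  assumes "even m"
  obtains s :: "'a alg_closure" where "s \<in> ext_field m" "s ^ CARD('a) + s = 1"
proof -
  let ?q = "CARD('a)"
  have "degree (monom 1 ?q + [:- 1, 1 :: 'a alg_closure:]) = ?q"
    using card_finite_field_ge_2[where ?'a = 'a]
    by (subst degree_add_eq_left) (simp_all add: degree_monom_eq)
  then obtain s :: "'a alg_closure" where "poly (monom 1 ?q + [:- 1, 1:]) s = 0"
    using alg_closed_imp_poly_has_root[of "monom 1 ?q + [:- 1, 1 :: 'a alg_closure:]"]
      card_finite_field_ge_2[where ?'a = 'a] by auto
  hence s: "s ^ ?q + s = 1"
    by (simp add: poly_monom add_diff_eq)
  hence "s ^ ?q = 1 - s"
    by (simp add: eq_diff_eq)
  hence sq: "s ^ ?q = 1 + s"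
    by (simp only: diff_conv_add_uminus neg_self)
  have "s ^ (?q ^ 2) = (s ^ ?q) ^ ?q"
    by (simp add: power2_eq_square power_mult)
  also have "\<dots> = 1 + s ^ ?q"
    unfolding sq frob_add1[OF card_eq] by simp
  also have "\<dots> = s"
    unfolding sq using double_zero[of 1] by (simp flip: add.assoc)
  finally have "s \<in> ext_field 2"
    by (simp add: ext_field_def)
  hence "s \<in> ext_field m"
    using ext_field_power_iterate[OF card_eq, of s 2 "m div 2"] assms
    by (simp add: ext_field_def flip: power_mult)
  thus ?thesis
    using s that by blast
qed

text \<open>This is the collision equation divided by z^q, after x = z s and z = v^(-2): then z /
  z^q = v^(2 q - 2) and (w / z) / z^q = v^(2 q + 1).\<close>

lemma witness_poly_not_injective_even:
  fixes v s :: "'a alg_closure"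
  assumes "m > 0" "v \<in> ext_field m" "v \<noteq> 0" "s \<in> ext_field m"
    and eq: "s ^ CARD('a) + s = 1 + v ^ (2 * CARD('a) - 2) + v ^ (2 * CARD('a) + 1)"
  shows "m \<notin> bij_degrees (witness_poly :: 'a poly)"
proof -
  let ?q = "CARD('a)"
  define w where "w = inverse v"
  define z where "z = w ^ 2"
  have w: "w \<noteq> 0" "w \<in> ext_field m"
    using assms(2,3) by (simp_all add: w_def ext_field_inverse)
  have z: "- (w ^ CHAR('a)) = z"
    by (simp only: char2 neg_self z_def)
  have z0: "z \<noteq> 0"
    using w by (simp add: z_def)
  have zq: "z ^ (?q - 1) * z = z ^ ?q"
    using power_minus_mult[of ?q z] finite_UNIV_card_ge_0[where ?'a = 'a] by simp
  have zv: "z ^ ?q * v ^ (2 * ?q) = 1"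
    using assms(3) by (simp add: z_def w_def power_inverse flip: power_mult)
  have "v ^ 2 * v ^ (2 * ?q - 2) = v ^ (2 * ?q)"
  proof -
    have "2 + (2 * ?q - 2) = 2 * ?q"
      using card_finite_field_ge_2[where ?'a = 'a] by simp
    thus ?thesis
      by (simp only: power_add[symmetric])
  qed
  hence "v ^ (2 * ?q - 2) = z * v ^ (2 * ?q)"
    using assms(3) by (simp add: z_def w_def field_simps)
  hence zv1: "z ^ ?q * v ^ (2 * ?q - 2) = z"
    using zv by (simp add: mult.left_commute)
  have zv2: "z ^ ?q * v ^ (2 * ?q + 1) = v"
    using zv by (simp add: mult.left_commute[of _ v])
  have "(z * s) ^ ?q + (z ^ (?q - 1) - 2) * (z * s) + (z ^ ?q - z) =
          z ^ ?q * s ^ ?q + z ^ (?q - 1) * z * s + (z ^ ?q - z)"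
    by (simp add: power_mult_distrib two_zero mult.assoc)
  also have "\<dots> = z ^ ?q * (s ^ ?q + s) + (z ^ ?q + z)"
    unfolding zq diff_conv_add_uminus neg_self by (simp add: distrib_left)
  also have "\<dots> = (z ^ ?q + z ^ ?q) + (z ^ ?q * v ^ (2 * ?q - 2) + z) + z ^ ?q * v ^ (2 * ?q + 1)"
    unfolding eq by (simp add: algebra_simps)
  also have "\<dots> = v"
    unfolding zv1 zv2 by (simp add: double_zero)
  also have "\<dots> = w / z"
    using assms(3) by (simp add: z_def w_def field_simps power2_eq_square)
  finally have "(z * s) ^ ?q + (z ^ (?q - 1) - 2) * (z * s) + (z ^ ?q - z) = w / z" .
  moreover have "z * s \<in> ext_field m"
    unfolding z_def by (intro ext_field_mult ext_field_power[OF card_eq] w assms(4))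
  ultimately show ?thesis
    using witness_poly_not_injective[OF card_eq assms(1) w, of "z * s"] unfolding z by blast
qed

text \<open>In binary, 2 q - 2 = 2 (2^n - 1) is a run of n ones from place 1, and 2 q + 1 has ones
  at 0 and n + 1. The powers q^i and 2^j shift by n i and j, cyclically since v^(2^(n m)) =
  v.\<close>

private lemma power_digits:
  fixes v :: "'a alg_closure"
  assumes v: "v \<in> ext_field m"
  shows "v ^ (\<Sum>b\<in>#digits n (n * m) j c. 2 ^ b) =
    (case c of None \<Rightarrow> 1 | Some (i, t) \<Rightarrow>
      ((if t then v ^ (2 * CARD('a) - 2) else v ^ (2 * CARD('a) + 1)) ^ (CARD('a) ^ i)) ^ (2 ^ j))"
proof -
  have mod: "v ^ (2 ^ (b mod (n * m))) = v ^ (2 ^ b)" for b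
  proof -
    have "(2 :: nat) ^ b = 2 ^ (b mod (n * m)) * (CARD('a) ^ m) ^ (b div (n * m))"
      by (simp add: card_2 flip: power_mult power_add)
    thus ?thesis
      using ext_field_power_iterate[OF card_eq ext_field_power[OF card_eq v]] by (simp add: power_mult)
  qed
  show ?thesis
  proof (cases c)
    case (Some it)
    obtain i t where it: "it = (i, t)"
      by force
    show ?thesis
    proof (cases t)
      case True
      have "v ^ (\<Sum>b\<in>#digits n (n * m) j c. 2 ^ b) = (\<Prod>k<n. v ^ (2 ^ ((j + 1 + n * i + k) mod (n * m))))"
        by (simp add: Some it True image_mset.compositionality comp_def sum_unfold_sum_mset[symmetric] power_sum)
      also have "\<dots> = v ^ (\<Sum>k<n. 2 ^ (j + 1 + n * i + k))"
        unfolding mod by (simp add: power_sum)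
      also have "(\<Sum>k<n. 2 ^ (j + 1 + n * i + k)) = (2 ^ (j + 1 + n * i) * (2 ^ n - 1) :: nat)"
        unfolding power_add[of _ "j + 1 + n * i"] sum_distrib_left[symmetric]
        using sum_power2[of n] by (simp add: atLeast0LessThan)
      also have "\<dots> = (2 * CARD('a) - 2) * CARD('a) ^ i * 2 ^ j"
      proof -
        have "(2 :: nat) ^ (j + 1 + n * i) = 2 * (CARD('a) ^ i * 2 ^ j)"
          by (simp add: card_2 power_add power_mult)
        moreover have "2 * CARD('a) - 2 = 2 * (2 ^ n - 1)"
          by (simp add: card_2)
        ultimately show ?thesis
          by (simp only: mult_ac)
      qed
      finally show ?thesis
        by (simp add: Some it True power_mult)
    next
      case False
      have "v ^ (\<Sum>b\<in>#digits n (n * m) j c. 2 ^ b) = v ^ (2 ^ (j + n * i)) * v ^ (2 ^ (j + n + 1 + n * i))"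
        by (simp add: Some it False power_add mod[simplified])
      also have "\<dots> = v ^ ((2 * CARD('a) + 1) * CARD('a) ^ i * 2 ^ j)"
      proof -
        have "(2 :: nat) ^ (j + n * i) = CARD('a) ^ i * 2 ^ j"
          and "(2 :: nat) ^ (j + n + 1 + n * i) = 2 * CARD('a) * (CARD('a) ^ i * 2 ^ j)"
          by (simp_all add: card_2 power_add power_mult)
        hence "(2 :: nat) ^ (j + n * i) + 2 ^ (j + n + 1 + n * i) = (2 * CARD('a) + 1) * CARD('a) ^ i * 2 ^ j"
          by (simp only: add_mult_distrib mult_1 mult.assoc add.commute)
        thus ?thesis
          by (simp only: power_add[symmetric])
      qed
      finally have eq: "v ^ (\<Sum>b\<in>#digits n (n * m) j c. 2 ^ b) = v ^ ((2 * CARD('a) + 1) * CARD('a) ^ i * 2 ^ j)" .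
      show ?thesis
        unfolding eq by (simp only: Some it False option.case prod.case if_False power_mult)
    qed
  qed simp
qed

text \<open>The j-th factor is (1 + F)^(2^j) with \<open>F\<close> the trace, so the product is (1 +
  F)^(q - 1), and 1 + F is a nonzero element of F_q.\<close>

private lemma prod_sum_power_digits:
  fixes v :: "'a alg_closure"
  assumes v: "v \<in> ext_field m"
    and "trace m (v ^ (2 * CARD('a) - 2) + v ^ (2 * CARD('a) + 1)) \<noteq> 1"
  shows "(\<Prod>j<n. \<Sum>c\<in>term_choices m. v ^ (\<Sum>b\<in>#digits n (n * m) j c. 2 ^ b)) = 1"
proof -
  let ?q = "CARD('a)"
  let ?A = "v ^ (2 * ?q - 2)" and ?B = "v ^ (2 * ?q + 1)"
  define F where "F = trace m (?A + ?B)"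
  have frob2: "(x + y) ^ (2 ^ j) = x ^ (2 ^ j) + y ^ (2 ^ j)" for x y :: "'a alg_closure" and j
    using char2 by (intro freshmans_dream'[where n = j]) simp_all
  have frob2_sum: "sum f S ^ (2 ^ j) = (\<Sum>i\<in>S. f i ^ (2 ^ j))"
    for f :: "nat \<Rightarrow> 'a alg_closure" and S j
    using char2 by (intro freshmans_dream_sum'[where n = j]) simp_all
  have "(\<Sum>c\<in>term_choices m. v ^ (\<Sum>b\<in>#digits n (n * m) j c. 2 ^ b)) = (1 + F) ^ (2 ^ j)" for j
  proof -
    let ?f = "\<lambda>(i, t). ((if t then ?A else ?B) ^ (?q ^ i)) ^ (2 ^ j)"
    have "(\<Sum>c\<in>term_choices m. v ^ (\<Sum>b\<in>#digits n (n * m) j c. 2 ^ b)) =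
            1 + (\<Sum>x\<in>{..<m} \<times> UNIV. ?f x)"
      unfolding power_digits[OF v] term_choices_def
      by (subst sum.insert) (auto simp: sum.reindex)
    also have "(\<Sum>x\<in>{..<m} \<times> UNIV. ?f x) = (\<Sum>i<m. (?A ^ (?q ^ i)) ^ (2 ^ j) + (?B ^ (?q ^ i)) ^ (2 ^ j))"
      by (simp add: sum.cartesian_product[symmetric] UNIV_bool add.commute)
    also have "\<dots> = F ^ (2 ^ j)"
      by (simp only: F_def trace_def frob2_sum frob_add[OF card_eq] frob2)
    finally show ?thesis
      by (simp add: frob2)
  qed
  hence "(\<Prod>j<n. \<Sum>c\<in>term_choices m. v ^ (\<Sum>b\<in>#digits n (n * m) j c. 2 ^ b)) =
           (1 + F) ^ (\<Sum>j<n. 2 ^ j)"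
    by (simp add: power_sum)
  also have "(\<Sum>j<n. 2 ^ j) = ?q - 1"
    using sum_power2[of n] by (simp add: card_2 atLeast0LessThan)
  also have "(1 + F) ^ (?q - 1) = 1"
  proof -
    have "?A + ?B \<in> ext_field m"
      by (intro ext_field_plus[OF card_eq] ext_field_power[OF card_eq] v)
    hence "(1 + F) ^ ?q = 1 + F"
      using trace_frob[OF card_eq] frob_add1[OF card_eq, of 1 F] by (simp add: F_def)
    hence "1 + F \<in> ext_field 1"
      by (simp add: ext_field_def)
    moreover have "1 + F \<noteq> 0"
      using assms(2) neg_self[of 1] add_eq_0_iff[of 1 F] by (auto simp: F_def)
    ultimately show ?thesis
      using ext_field_power_card_minus_1[OF card_eq, of "1 + F" 1] by simp
  qed
  finally show ?thesis .
qed

text \<open>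
  If the trace never took the value \<open>1\<close>, then \<open>(1 + trace)^(q - 1)\<close> would be the constant function
  \<open>1\<close>, whereas the hypotheses say that the monomial with exponent \<open>set_encode B\<close> occurs in it
  exactly once.
\<close>

private lemma exists_trace_eq_1:
  assumes m: "m > 0" and B: "B \<subset> {..<n * m}" "B \<noteq> {}"
    and size: "\<And>\<phi>. \<phi> \<in> (\<Pi>\<^sub>E j\<in>{..<n}. term_choices m) \<Longrightarrow>
                (\<Sum>j<n. size (digits n (n * m) j (\<phi> j))) \<le> card B"
    and \<phi>0: "\<phi>0 \<in> (\<Pi>\<^sub>E j\<in>{..<n}. term_choices m)"
    and unique: "\<And>\<phi>. \<phi> \<in> (\<Pi>\<^sub>E j\<in>{..<n}. term_choices m) \<Longrightarrow>
                (\<Sum>j<n. digits n (n * m) j (\<phi> j)) = mset_set B \<longleftrightarrow> \<phi> = \<phi>0"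
  shows "\<exists>v\<in>ext_field m. trace m (v ^ (2 * CARD('a) - 2) + v ^ (2 * CARD('a) + 1)) = (1 :: 'a alg_closure)"
proof (rule ccontr)
  assume no: "\<not> ?thesis"
  let ?L = "ext_field m :: 'a alg_closure set"
  let ?\<Phi> = "\<Pi>\<^sub>E j\<in>{..<n}. term_choices m"
  define K where "K = n * m"
  define D where "D = set_encode B"
  \<comment> \<open>Complementary exponent: v^e moves the monomial v^D to v^(q^m - 1), whose power
    sum is -1.\<close>
  define e where "e = 2 ^ K - 1 - D"
  define val where "val = (\<lambda>\<phi>. \<Sum>b\<in>#(\<Sum>j<n. digits n K j (\<phi> j)). (2 :: nat) ^ b)"
  have Q: "CARD('a) ^ m = 2 ^ K"
    by (simp add: card_2 K_def power_mult)
  have K: "K > 0"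
    using m n_pos by (simp add: K_def)
  have fin: "finite B"
    using B(1) finite_subset by blast
  have "D \<noteq> 0"
    using set_encode_eq[OF fin finite.emptyI] B(2) by (auto simp: D_def)
  moreover have "D \<noteq> 2 ^ K - 1"
    using set_encode_eq[OF fin finite_lessThan[of K]] B(1) by (auto simp: D_def K_def set_encode_lessThan)
  moreover have "D \<le> 2 ^ K - 1"
    unfolding D_def set_encode_lessThan[symmetric] set_encode_def
    using B(1) by (intro sum_mono2) (auto simp: K_def)
  ultimately have e: "0 < e" "e < 2 ^ K - 1" "e + D = 2 ^ K - 1"
    by (auto simp: e_def)
  have dvd_iff: "2 ^ K - 1 dvd e + val \<phi> \<longleftrightarrow> \<phi> = \<phi>0" if \<phi>: "\<phi> \<in> ?\<Phi>" for \<phi>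
  proof -
    let ?M = "\<Sum>j<n. digits n K j (\<phi> j)"
    have "set_mset ?M \<subseteq> {..<K}"
      using K by (auto simp: set_mset_sum_eq_UN dest: digits_less)
    moreover have "size ?M \<le> card B"
      using size[OF \<phi>] by (simp add: size_sum_multiset K_def)
    ultimately have "[val \<phi> = D] (mod (2 ^ K - 1)) \<Longrightarrow> ?M = mset_set B"
      unfolding val_def D_def using B by (intro power2_sum_mset_unique) (auto simp: K_def)
    moreover have "val \<phi> = D" if "?M = mset_set B"
      unfolding val_def that D_def set_encode_def by (simp add: sum_unfold_sum_mset)
    ultimately have "[val \<phi> = D] (mod (2 ^ K - 1)) \<longleftrightarrow> ?M = mset_set B"
      by auto
    also have "\<dots> \<longleftrightarrow> \<phi> = \<phi>0"
      using unique[OF \<phi>] by (simp add: K_def)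
    also have "[val \<phi> = D] (mod (2 ^ K - 1)) \<longleftrightarrow> [e + val \<phi> = e + D] (mod (2 ^ K - 1))"
      by (simp add: cong_add_lcancel_nat)
    also have "\<dots> \<longleftrightarrow> 2 ^ K - 1 dvd e + val \<phi>"
      unfolding e(3) by (simp add: cong_def dvd_eq_mod_eq_0)
    finally show ?thesis .
  qed
  have expand: "v ^ e = (\<Sum>\<phi>\<in>?\<Phi>. v ^ (e + val \<phi>))" if v: "v \<in> ?L" for v
  proof -
    have "1 = (\<Prod>j<n. \<Sum>c\<in>term_choices m. v ^ (\<Sum>b\<in>#digits n K j c. 2 ^ b))"
      using prod_sum_power_digits[OF v] no v by (simp add: K_def)
    also have "\<dots> = (\<Sum>\<phi>\<in>?\<Phi>. \<Prod>j<n. v ^ (\<Sum>b\<in>#digits n K j (\<phi> j). 2 ^ b))"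
      by (rule prod_sum_PiE) simp_all
    also have "\<dots> = (\<Sum>\<phi>\<in>?\<Phi>. v ^ val \<phi>)"
    proof (intro sum.cong refl)
      fix \<phi>
      have "(\<Sum>b\<in>#(\<Sum>j\<in>J. digits n K j (\<phi> j)). (2 :: nat) ^ b) =
              (\<Sum>j\<in>J. \<Sum>b\<in>#digits n K j (\<phi> j). 2 ^ b)" for J :: "nat set"
        by (induction J rule: infinite_finite_induct) simp_all
      thus "(\<Prod>j<n. v ^ (\<Sum>b\<in>#digits n K j (\<phi> j). 2 ^ b)) = v ^ val \<phi>"
        by (simp add: val_def power_sum)
    qed
    finally have "v ^ e * 1 = v ^ e * (\<Sum>\<phi>\<in>?\<Phi>. v ^ val \<phi>)"
      by (rule arg_cong)
    thus ?thesis
      by (simp add: power_add sum_distrib_left)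
  qed
  \<comment> \<open>Summing \<open>expand\<close> over the field gives 0 on the left, as 0 < e < q^m
    - 1, and -1 from \<open>\<phi>0\<close> alone on the right.\<close>
  have "0 = (\<Sum>v\<in>?L. v ^ e)"
    using e m by (subst power_sum_ext_field[OF card_eq]) (auto simp: Q dest: dvd_imp_le)
  also have "\<dots> = (\<Sum>v\<in>?L. \<Sum>\<phi>\<in>?\<Phi>. v ^ (e + val \<phi>))"
    by (intro sum.cong refl expand)
  also have "\<dots> = (\<Sum>\<phi>\<in>?\<Phi>. \<Sum>v\<in>?L. v ^ (e + val \<phi>))"
    by (rule sum.swap)
  also have "\<dots> = (\<Sum>\<phi>\<in>?\<Phi>. if \<phi> = \<phi>0 then -1 else 0)"
    using e(1) m by (intro sum.cong refl) (simp only: power_sum_ext_field[OF card_eq] Q dvd_iff add_pos_nonneg zero_le)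
  also have "\<dots> = -1"
    using \<phi>0 by (simp add: finite_PiE)
  finally show False
    by simp
qed

text \<open>The bound 2 n + 3 covers both the 2 n + 2 needed by the spaced runs and the m > 4 needed
  for q = 2.\<close>

lemma exists_trace_one:
  assumes "m \<ge> 2 * n + 3"
  shows "\<exists>v\<in>ext_field m. trace m (v ^ (2 * CARD('a) - 2) + v ^ (2 * CARD('a) + 1)) = (1 :: 'a alg_closure)"
proof (cases "n = 1")
  case False
  hence n: "n \<ge> 2"
    using n_pos by simp
  have "spaced_runs n \<subseteq> {..<n * m}"
    using spaced_runs_less[of _ n m] assms by fastforce
  \<comment> \<open>The free place 0 makes the inclusion proper.\<close>
  moreover have "0 \<notin> spaced_runs n" "0 \<in> {..<n * m}"
    using assms n by (simp_all add: spaced_runs_iff)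
  ultimately have runs: "spaced_runs n \<subset> {..<n * m}" "spaced_runs n \<noteq> {}"
    using card_spaced_runs[of n] n by auto
  show ?thesis
  proof (rule exists_trace_eq_1[OF _ runs])
    show "(\<Sum>j<n. size (digits n (n * m) j (\<phi> j))) \<le> card (spaced_runs n)" for \<phi>
      using sum_bounded_above[of "{..<n}" "\<lambda>j. size (digits n (n * m) j (\<phi> j))" n] size_digits_le[OF n]
      by (simp add: card_spaced_runs)
    show "(\<lambda>j\<in>{..<n}. Some (2 * j, True)) \<in> (\<Pi>\<^sub>E j\<in>{..<n}. term_choices m)"
      using assms by (auto simp: term_choices_def)
    show "(\<Sum>j<n. digits n (n * m) j (\<phi> j)) = mset_set (spaced_runs n) \<longleftrightarrow>
            \<phi> = (\<lambda>j\<in>{..<n}. Some (2 * j, True))"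
      if "\<phi> \<in> (\<Pi>\<^sub>E j\<in>{..<n}. term_choices m)" for \<phi>
      using digits_spaced_runs_unique[OF n _ that] assms by simp
  qed (use assms in simp)
next
  case True
  have "1 \<notin> {0 :: nat, 2}" "1 \<in> {..<n * m}" "{0, 2} \<subseteq> {..<n * m}"
    using assms by (auto simp: True)
  hence bits: "{0, 2} \<subset> {..<n * m}" "{0 :: nat, 2} \<noteq> {}"
    by blast+
  show ?thesis
  proof (rule exists_trace_eq_1[OF _ bits])
    have "size (digits 1 (1 * m) 0 c) \<le> 2" for c
      by (cases "(1 :: nat, 1 * m, 0 :: nat, c)" rule: digits.cases) auto
    thus "(\<Sum>j<n. size (digits n (n * m) j (\<phi> j))) \<le> card {0 :: nat, 2}" for \<phi>
      by (simp add: True lessThan_Suc numeral_2_eq_2)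
    show "(\<lambda>j\<in>{..<n}. Some (0, False)) \<in> (\<Pi>\<^sub>E j\<in>{..<n}. term_choices m)"
      using assms by (auto simp: term_choices_def)
    show "(\<Sum>j<n. digits n (n * m) j (\<phi> j)) = mset_set {0, 2} \<longleftrightarrow>
            \<phi> = (\<lambda>j\<in>{..<n}. Some (0, False))"
      if "\<phi> \<in> (\<Pi>\<^sub>E j\<in>{..<n}. term_choices m)" for \<phi>
      using digits_one_unique[of m \<phi>] assms that unfolding True by simp
  qed (use assms in simp)
qed

lemma witness_poly_even:
  assumes "m \<ge> 2 * n + 3"
  shows "m \<notin> bij_degrees (witness_poly :: 'a poly)"
proof (cases "even m")
  case True
  obtain s :: "'a alg_closure" where "s \<in> ext_field m" "s ^ CARD('a) + s = 1"
    using frob_add_eq_1_even[OF True] .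
  \<comment> \<open>At v = 1 the right side is 1 + 1 + 1 = 1.\<close>
  thus ?thesis
    using assms double_zero[of 1] one_in_ext_field[OF card_eq]
    by (intro witness_poly_not_injective_even[of m 1 s]) (auto simp: add.assoc)
next
  case False
  obtain v :: "'a alg_closure" where v: "v \<in> ext_field m"
    "trace m (v ^ (2 * CARD('a) - 2) + v ^ (2 * CARD('a) + 1)) = 1"
    using exists_trace_one[OF assms] by blast
  let ?y = "1 + v ^ (2 * CARD('a) - 2) + v ^ (2 * CARD('a) + 1)"
  have odd: "of_nat m = (1 :: 'a alg_closure)"
    using False two_zero by (elim oddE) simp
  \<comment> \<open>For odd m the constant 1 has trace 1, which cancels the trace obtained from
    v.\<close>
  have "trace m ?y = 1 + 1"
    unfolding add.assoc by (simp only: trace_add[OF card_eq] trace_one odd)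
       (simp only: v(2) trace_add[OF card_eq, symmetric])
  hence "trace m ?y = 0"
    by (simp only: double_zero)
  moreover have "?y \<in> ext_field m"
    by (intro ext_field_plus[OF card_eq] ext_field_power[OF card_eq] one_in_ext_field[OF card_eq] v)
  ultimately obtain s where s: "s \<in> ext_field m" "s - s ^ CARD('a) = of_nat m * ?y"
    using trace_zero_imp_frob_diff[OF card_eq] by blast
  have "s ^ CARD('a) + s = ?y"
    using s(2) unfolding odd diff_conv_add_uminus neg_self by (simp only: add.commute mult_1)
  moreover have "v \<noteq> 0"
  proof
    assume "v = 0"
    moreover have "2 * CARD('a) - 2 > 0"
      using card_finite_field_ge_2[where ?'a = 'a] by simp
    ultimately have "trace m (v ^ (2 * CARD('a) - 2) + v ^ (2 * CARD('a) + 1)) = trace m 0"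
      by (simp add: power_0_left)
    thus False
      using v(2) finite_UNIV_card_ge_0[where ?'a = 'a] by (simp add: trace_def power_0_left)
  qed
  ultimately show ?thesis
    using assms v(1) s(1) by (intro witness_poly_not_injective_even[of m v s]) auto
qed

end

section \<open>Combining the lower bound with the witness\<close>

theorem proposition6p7:
  fixes p n q :: nat
  assumes "prime p" and "n > 0" and "q = p ^ n"
    and "CARD('a::finite_field) = q"
  shows "nu_polys TYPE('a) \<noteq> {}
    \<and> nu TYPE('a) \<ge> p * (q + 1)
    \<and> (odd q \<or> q = 2 \<longrightarrow> nu TYPE('a) = p * (q + 1))
    \<and> (even q \<and> q > 2 \<longrightarrow>
         p * (q + 1) \<le> nu TYPE('a)
         \<and> nu TYPE('a) \<le> p * (q + least_prime_divisor (q - 1) - 1))"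
proof -
  have "CHAR('a) dvd p ^ n"
    using CHAR_dvd_CARD[where ?'a = 'a] assms(3,4) by simp
  hence CHAR: "CHAR('a) = p"
    using assms(1) prime_CHAR_finite_field[where ?'a = 'a] by (metis prime_dvd_power primes_dvd_imp_eq)
  have card_eq: "CARD('a) = CHAR('a) ^ n"
    using assms(3,4) CHAR by simp
  have "bij_degrees (witness_poly :: 'a poly) \<subseteq> {..<2 * n + 3}"
  proof
    fix m assume "m \<in> bij_degrees (witness_poly :: 'a poly)"
    hence "\<not> m \<ge> 2 * n + 3"
      using witness_poly_even[OF card_eq _ assms(2)] witness_poly_odd[OF card_eq, of m]
      by (cases "CHAR('a) = 2") auto
    thus "m \<in> {..<2 * n + 3}"
      by simp
  qed
  hence "\<not> exceptional (witness_poly :: 'a poly)"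
    unfolding exceptional_def using finite_subset by blast
  hence witness: "(witness_poly :: 'a poly) \<in> nu_polys TYPE('a)"
    by (simp add: nu_polys_def pderiv_witness_poly poly_witness_poly_base)
  have "nu TYPE('a) \<le> degree (witness_poly :: 'a poly)"
    unfolding nu_def using witness by (intro cInf_lower) auto
  hence upper: "nu TYPE('a) \<le> p * (q + 1)"
    by (simp only: degree_witness_poly CHAR assms(4))
  have lower: "p * (q + 1) \<le> nu TYPE('a)"
    unfolding nu_def
  proof (rule cInf_greatest)
    show "degree ` nu_polys TYPE('a) \<noteq> {}"
      using witness by blast
    show "p * (q + 1) \<le> d" if "d \<in> degree ` nu_polys TYPE('a)" for d
      using that degree_nu_polys_ge[OF card_eq assms(2)] by (auto simp: CHAR assms(4))
  qed
  \<comment> \<open>The upper bound for even q > 2 follows from the equality already obtained, as a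
    prime divisor is at least 2.\<close>
  have "p * (q + 1) \<le> p * (q + least_prime_divisor (q - 1) - 1)" if "q > 2"
  proof -
    have "\<exists>r. prime r \<and> r dvd q - 1"
      using that by (intro prime_factor_nat) simp
    hence "prime (least_prime_divisor (q - 1))"
      unfolding least_prime_divisor_def by (rule LeastI2_ex) simp
    hence "least_prime_divisor (q - 1) \<ge> 2"
      by (rule prime_ge_2_nat)
    thus ?thesis
      by (intro mult_le_mono2) simp
  qed
  thus ?thesis
    using witness lower upper by auto
qed

end
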